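(* Assume that $a>4L_F$ and that there is $\gamma\in(0,\frac a2)$ such that $$\frac{2c_2|\beta|}{\alpha}\left(\frac1\gamma+\frac1{a-2\gamma}\right)<1,$$ where $a=\frac\alpha2-\left|\frac\alpha2-\frac{\delta K\lambda_1}{\alpha}\right|$ and $L_F=\frac{2c_2|\beta|}{\alpha}$. Then the global random attractor $\omega\mapsto A_0(\omega)\subset E$ of the random dynamical system $Y$ generated by $\dot u=v+z(\theta_t\omega)$, $\dot v=-KAu-\alpha v+f-\beta g(u)+(1-\alpha)z(\theta_t\omega)$ is a random horizontal curve.
   Context: Data. $N\ge2$, $d\ge1$ are integers, $\mathbb{Z}^d_N=\{j\in\mathbb{Z}^d:1\le j_1,\dots,j_d\le N\}$; $\alpha,K>0$, $\beta\in\mathbb{R}$, $\delta\in(0,1]$, and $f=(f_j)$, $(\epsilon_j)$ are constant vectors in $\mathbb{R}^{N^d}$ indexed by $\mathbb{Z}^d_N$. $A$ is an $N^d\times N^d$ nonnegative definite symmetric matrix with eigenvalues $0=\lambda_0<\lambda_1\le\dots\le\lambda_{N^d-1}$, with $\lambda_0=0$ algebraically simple and $(1,\dots,1)^\top$ an eigenvector for $\lambda_0$. $g\in C^1(\mathbb{R},\mathbb{R})$ satisfies $g(x+\kappa)=g(x)$, $|g(x)|\le c_1$, $|g'(x)|\le c_2$ for all $x$, where $c_1,c_2>0$ and $\kappa>0$ is the smallest positive period of $g$; $g(u)=(g(u_j))_j$ for $u\in\mathbb{R}^{N^d}$. Noise. $\Omega_0=\{\omega_0\in C(\mathbb{R},\mathbb{R}):\omega_0(0)=0\}$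 with the compact-open topology, Borel $\sigma$-algebra and (two-sided) Wiener measure; $(\Omega,\mathcal{F},\mathbb{P})$ is the product of copies of this space over $j\in\mathbb{Z}^d_N$; $\theta_t\omega(\cdot)=\omega(\cdot+t)-\omega(t)$. $W(t)=(\epsilon_jW_j(t))_j$ with $W_j(t)(\omega)=\omega_j(t)$. $z(\theta_t\omega)=(z_j(\theta_t\omega))_j$ is the unique stationary solution of $dz+z\,dt=dW(t)$ in $\mathbb{R}^{N^d}$ (explicitly $z_j(\omega)=-\epsilon_j\int_{-\infty}^0e^s\omega_j(s)\,ds$). $\Omega$ is replaced, without change of notation, by a $\theta_t$-invariant full-measure subset on which every $t\mapsto z_j(\theta_t\omega)$ is continuous and $\lim_{|t|\to\infty}e^{-\epsilon|t|}|z_j(\theta_t\omega)|=0$ for every $\epsilon>0$. System and spaces. $E=\mathbb{R}^{N^d}\times\mathbb{R}^{N^d}$; $Y(t,\omega,Y_0)$, $t\ge0$, is the solution $(u,v)^\top$ of the random system in the claim with $Y(0,\omega,Y_0)=Y_0\in E$. $\eta_0=(1,\dots,1,0,\dots,0)^\top$, $\eta_{-1}=(1,\dots,1,-\alpha,\dots,-\alpha)^\top\in E$; $E_1=\mathrm{span}\{\eta_0\}$, $E_{-1}=\mathrm{span}\{\eta_{-1}\}$, $E_{11}=E_1+E_{-1}$, $E_{22}=E_{11}^\perp$ (Euclidean orthogonal complement in $E$), $E_2=E_{-1}\oplus E_{22}$, so $E=E_1\oplus E_2$; $P$ and $Q=I-P$ are the corresponding projections onto $E_1$ and $E_2$. $p_0=\kappa\eta_0$.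 Norm. With $\langle\cdot,\cdot\rangle$, $\|\cdot\|$ Euclidean and $Y_i=(u_i,v_i)^\top$: on $E_{11}$, $\langle Y_1,Y_2\rangle_{E_{11}}=\frac{\alpha^2}4\langle u_1,u_2\rangle+\langle\frac\alpha2u_1+v_1,\frac\alpha2u_2+v_2\rangle$; on $E_{22}$, $\langle Y_1,Y_2\rangle_{E_{22}}=\langle KAu_1,u_2\rangle+(\frac{\alpha^2}4-\delta K\lambda_1)\langle u_1,u_2\rangle+\langle\frac\alpha2u_1+v_1,\frac\alpha2u_2+v_2\rangle$; $\langle\cdot,\cdot\rangle_E$ on $E=E_{11}\oplus E_{22}$ is the sum of the two forms evaluated on components. It is an inner product with norm $\|\cdot\|_E$ equivalent to the Euclidean norm; $E_1\perp E_2$ for it, and $L_F$ is the Lipschitz constant in $Y=(u,v)$, with respect to $\|\cdot\|_E$, of $(z(\theta_t\omega),f-\beta g(u)+(1-\alpha)z(\theta_t\omega))^\top$. Attractor. Since $Y(t,\omega,Y_0+kp_0)=Y(t,\omega,Y_0)+kp_0$ for $k\in\mathbb{Z}$, $Y$ induces a random dynamical system $\mathbf{Y}(t,\omega,Y_0\ (\mathrm{mod}\,p_0))=Y(t,\omega,Y_0)\ (\mathrm{mod}\,p_0)$ on $\mathbf{E}=(E_1/p_0\mathbb{Z})\times E_2$. Its global random attractor (random compact invariant set, $\mathbf{Y}(t,\omega,\mathbf{A_0}(\omega))=\mathbf{A_0}(\theta_t\omega)$, attracting all tempered random sets in the pullback sense) is $$\mathbf{A_0}(\omega)=\bigcap_{t>0}\overline{\bigcup_{\tau\ge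 t}\mathbf{Y}(\tau,\theta_{-\tau}\omega,\mathbf{B_0}(\theta_{-\tau}\omega))},$$ where $\mathbf{B_0}(\omega)=\{Y\ (\mathrm{mod}\,p_0):Y\in E,\ \|QY\|_E\le R_0(\omega)\}$, $R_0(\omega)=\frac{4a_1}{a}\tilde r(\omega)+\frac{2a_2}{a}$, $a_1=M_1\sqrt{3\alpha^2-6\alpha+4}$, $a_2=M_1\sqrt{3\|f\|^2+3\beta^2c_1^2N^d}$, $M_1>0$ is a constant with $\|\cdot\|_E\le M_1\|\cdot\|$ on $E$, and $\tilde r>0$ is a tempered random variable with $\|z(\theta_t\omega)\|\le e^{\frac a2|t|}\tilde r(\omega)$ and $e^{-\frac a2|t|}\tilde r(\omega)\le\tilde r(\theta_t\omega)\le e^{\frac a2|t|}\tilde r(\omega)$ for all $t\in\mathbb{R}$, $\omega\in\Omega$ (such $\tilde r$ exists; a random variable $r>0$ is tempered if $e^{-bt}r(\theta_{-t}\omega)\to0$ as $t\to\infty$ for all $b>0$, $\mathbb{P}$-a.s.). The global random attractor of $Y$ is the lift $A_0(\omega)=\{Y\in E:Y\ (\mathrm{mod}\,p_0)\in\mathbf{A_0}(\omega)\}$. Random horizontal curve. A random set $\omega\mapsto\ell(\omega)\subset E$ (i.e. $\omega\mapsto\inf_{y\in\ell(\omega)}\|x-y\|_E$ is measurable for each $x\in E$) is a random horizontal curve if $\ell(\omega)=\{(p,\Phi^\omega(p)):p\in E_1\}$ (that is, $\{p+\Phi^\omega(p):p\in E_1\}$) for maps $\Phi^\omega:E_1\to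 E_2$ with $\|\Phi^\omega(p_1)-\Phi^\omega(p_2)\|_E\le\|p_1-p_2\|_E$ and $\Phi^\omega(p+p_0)=\Phi^\omega(p)$ for all $p,p_1,p_2\in E_1$, $\omega\in\Omega$. *)

theory Defs
  imports "HOL-Probability.Probability"
begin

section \<open>Wiener space and the shift\<close>

definition path_space :: "(real \<Rightarrow> real) set" where
  "path_space = {w. continuous_on UNIV w \<and> w 0 = 0}"

definition compact_open_paths :: "(real \<Rightarrow> real) topology" where
  "compact_open_paths =
     topology_generated_by {{w \<in> path_space. w ` C \<subseteq> U} | C U. compact C \<and> open U}"

definition borel_paths :: "(real \<Rightarrow> real) measure" where
  "borel_paths = sigma path_space {S. openin compact_open_paths S}"

text \<open>
  Two-sided Wiener measure is the only probability measure on the Borel sets of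
  \<^term>\<open>path_space\<close> satisfying the two conditions on increments below.
\<close>

definition two_sided_wiener :: "(real \<Rightarrow> real) measure \<Rightarrow> bool" where
  "two_sided_wiener W \<longleftrightarrow>
     prob_space W \<and> space W = path_space \<and> sets W = sets borel_paths \<and>
     (\<forall>s t. s < t \<longrightarrow>
        distributed W lborel (\<lambda>w. w t - w s) (normal_density 0 (sqrt (t - s)))) \<and>
     (\<forall>(n::nat) (t :: nat \<Rightarrow> real). (\<forall>i<n. t i < t (Suc i)) \<longrightarrow>
        prob_space.indep_vars W (\<lambda>_. borel) (\<lambda>i w. w (t (Suc i)) - w (t i)) {..<n})"

type_synonym 'j noise = "'j \<Rightarrow> real \<Rightarrow> real"

definition noise_space :: "(real \<Rightarrow> real) measure \<Rightarrow> 'j::finite noise measure" where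
  "noise_space W = PiM UNIV (\<lambda>_. W)"

definition shift :: "real \<Rightarrow> 'j noise \<Rightarrow> 'j noise" where
  "shift t \<omega> = (\<lambda>j s. \<omega> j (s + t) - \<omega> j t)"

definition ou :: "real^'j \<Rightarrow> 'j::finite noise \<Rightarrow> real^'j" where
  "ou eps \<omega> = (\<chi> j. - (eps $ j) * (LINT s:{..0}|lborel. exp s * \<omega> j s))"

text \<open>
  The full-measure sets that may replace the whole product space. Integrability of
  \<open>exp s * \<omega> j s\<close> is not required: where it fails, the integral is \<open>0\<close> by convention,
  and only the regularity of \<open>t \<mapsto> ou eps (shift t \<omega>)\<close> stated here is asked for.
\<close>

definition good_noise_set ::
  "(real \<Rightarrow> real) measure \<Rightarrow> real^'j \<Rightarrow> 'j::finite noise set \<Rightarrow> bool" where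
  "good_noise_set W eps \<Omega> \<longleftrightarrow>
     \<Omega> \<in> sets (noise_space W) \<and> emeasure (noise_space W) \<Omega> = 1 \<and>
     (\<forall>t. shift t ` \<Omega> = \<Omega>) \<and>
     (\<forall>\<omega>\<in>\<Omega>. \<forall>j.
        continuous_on UNIV (\<lambda>t. ou eps (shift t \<omega>) $ j) \<and>
        (\<forall>e>0. ((\<lambda>t. exp (- e * \<bar>t\<bar>) * \<bar>ou eps (shift t \<omega>) $ j\<bar>) \<longlongrightarrow> 0) at_infinity))"

definition tempered_rv :: "'j noise measure \<Rightarrow> ('j noise \<Rightarrow> real) \<Rightarrow> bool" where
  "tempered_rv M r \<longleftrightarrow>
     r \<in> borel_measurable M \<and> (\<forall>\<omega>\<in>space M. 0 < r \<omega>) \<and>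
     (AE \<omega> in M. \<forall>b>0. ((\<lambda>t. exp (- b * t) * r (shift (- t) \<omega>)) \<longlongrightarrow> 0) at_top)"


section \<open>Coefficients of the system\<close>

text \<open>
  The eigenvalues of \<open>A\<close>, counted with algebraic multiplicity, are
  \<open>lam 0, \<dots>, lam (n - 1)\<close> where \<open>n\<close> is the size of \<open>A\<close>, and
  \<open>0 = lam 0 < lam 1 \<le> \<dots> \<le> lam (n - 1)\<close>. In particular \<open>0\<close> is algebraically simple.
\<close>

definition simple_zero_spectrum :: "real^'j^'j::finite \<Rightarrow> (nat \<Rightarrow> real) \<Rightarrow> bool" where
  "simple_zero_spectrum A lam \<longleftrightarrow>
     (\<forall>x. det (mat x - A) = (\<Prod>i<CARD('j). x - lam i)) \<and>
     lam 0 = 0 \<and> 0 < lam 1 \<and>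
     (\<forall>i k. 1 \<le> i \<longrightarrow> i \<le> k \<longrightarrow> k < CARD('j) \<longrightarrow> lam i \<le> lam k)"

definition smallest_period :: "(real \<Rightarrow> real) \<Rightarrow> real \<Rightarrow> bool" where
  "smallest_period g \<kappa> \<longleftrightarrow>
     0 < \<kappa> \<and> (\<forall>x. g (x + \<kappa>) = g x) \<and> (\<forall>p>0. (\<forall>x. g (x + p) = g x) \<longrightarrow> \<kappa> \<le> p)"

type_synonym 'j phase = "(real^'j) \<times> (real^'j)"

definition vector_field ::
  "real^'j^'j \<Rightarrow> real \<Rightarrow> real \<Rightarrow> real \<Rightarrow> real^'j \<Rightarrow> (real \<Rightarrow> real) \<Rightarrow> real^'j
     \<Rightarrow> 'j::finite phase \<Rightarrow> 'j phase" where
  "vector_field A \<alpha> K \<beta> f g z = (\<lambda>(u, v).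
     (v + z,
      - (K *\<^sub>R (A *v u)) - \<alpha> *\<^sub>R v + f - \<beta> *\<^sub>R (\<chi> j. g (u $ j)) + (1 - \<alpha>) *\<^sub>R z))"

definition solution_map ::
  "real^'j^'j \<Rightarrow> real \<Rightarrow> real \<Rightarrow> real \<Rightarrow> real^'j \<Rightarrow> (real \<Rightarrow> real) \<Rightarrow> real^'j
     \<Rightarrow> 'j::finite noise set \<Rightarrow> (real \<Rightarrow> 'j noise \<Rightarrow> 'j phase \<Rightarrow> 'j phase) \<Rightarrow> bool" where
  "solution_map A \<alpha> K \<beta> f g eps \<Omega> Y \<longleftrightarrow>
     (\<forall>\<omega>\<in>\<Omega>. \<forall>Y0. Y 0 \<omega> Y0 = Y0 \<and>
        (\<forall>t\<ge>0. ((\<lambda>t. Y t \<omega> Y0) has_vector_derivative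
            vector_field A \<alpha> K \<beta> f g (ou eps (shift t \<omega>)) (Y t \<omega> Y0)) (at t within {0..})))"


section \<open>Splitting of the phase space\<close>

definition eta0 :: "'j::finite phase" where
  "eta0 = (vec 1, 0)"

definition eta_m1 :: "real \<Rightarrow> 'j::finite phase" where
  "eta_m1 \<alpha> = (vec 1, vec (- \<alpha>))"

definition E1 :: "'j::finite phase set" where
  "E1 = span {eta0}"

definition E_m1 :: "real \<Rightarrow> 'j::finite phase set" where
  "E_m1 \<alpha> = span {eta_m1 \<alpha>}"

definition E11 :: "real \<Rightarrow> 'j::finite phase set" where
  "E11 \<alpha> = {x + y | x y. x \<in> E1 \<and> y \<in> E_m1 \<alpha>}"

definition E22 :: "real \<Rightarrow> 'j::finite phase set" where
  "E22 \<alpha> = orthogonal_comp (E11 \<alpha>)"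

definition E2 :: "real \<Rightarrow> 'j::finite phase set" where
  "E2 \<alpha> = {x + y | x y. x \<in> E_m1 \<alpha> \<and> y \<in> E22 \<alpha>}"

text \<open>Projection onto \<open>S\<close> along \<open>T\<close>, for complementary subspaces \<open>S\<close> and \<open>T\<close>.\<close>

definition proj_along :: "'a::real_vector set \<Rightarrow> 'a set \<Rightarrow> 'a \<Rightarrow> 'a" where
  "proj_along S T y = (THE p. p \<in> S \<and> y - p \<in> T)"

definition P_E1 :: "real \<Rightarrow> 'j::finite phase \<Rightarrow> 'j phase" where
  "P_E1 \<alpha> = proj_along E1 (E2 \<alpha>)"

definition Q_E2 :: "real \<Rightarrow> 'j::finite phase \<Rightarrow> 'j phase" where
  "Q_E2 \<alpha> y = y - P_E1 \<alpha> y"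


section \<open>The adapted norm\<close>

definition inner_E11 :: "real \<Rightarrow> 'j::finite phase \<Rightarrow> 'j phase \<Rightarrow> real" where
  "inner_E11 \<alpha> = (\<lambda>(u1, v1) (u2, v2).
     \<alpha>\<^sup>2 / 4 * (u1 \<bullet> u2) + ((\<alpha> / 2) *\<^sub>R u1 + v1) \<bullet> ((\<alpha> / 2) *\<^sub>R u2 + v2))"

definition inner_E22 ::
  "real^'j^'j \<Rightarrow> real \<Rightarrow> real \<Rightarrow> real \<Rightarrow> real \<Rightarrow> 'j::finite phase \<Rightarrow> 'j phase \<Rightarrow> real" where
  "inner_E22 A \<alpha> K \<delta> lam1 = (\<lambda>(u1, v1) (u2, v2).
     (K *\<^sub>R (A *v u1)) \<bullet> u2 + (\<alpha>\<^sup>2 / 4 - \<delta> * K * lam1) * (u1 \<bullet> u2)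
       + ((\<alpha> / 2) *\<^sub>R u1 + v1) \<bullet> ((\<alpha> / 2) *\<^sub>R u2 + v2))"

definition inner_E ::
  "real^'j^'j \<Rightarrow> real \<Rightarrow> real \<Rightarrow> real \<Rightarrow> real \<Rightarrow> 'j::finite phase \<Rightarrow> 'j phase \<Rightarrow> real" where
  "inner_E A \<alpha> K \<delta> lam1 x y =
     inner_E11 \<alpha> (proj_along (E11 \<alpha>) (E22 \<alpha>) x) (proj_along (E11 \<alpha>) (E22 \<alpha>) y)
   + inner_E22 A \<alpha> K \<delta> lam1 (proj_along (E22 \<alpha>) (E11 \<alpha>) x) (proj_along (E22 \<alpha>) (E11 \<alpha>) y)"

definition norm_E ::
  "real^'j^'j \<Rightarrow> real \<Rightarrow> real \<Rightarrow> real \<Rightarrow> real \<Rightarrow> 'j::finite phase \<Rightarrow> real" where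
  "norm_E A \<alpha> K \<delta> lam1 x = sqrt (inner_E A \<alpha> K \<delta> lam1 x x)"


section \<open>The cylinder and the induced system\<close>

definition quotient_topology :: "'a topology \<Rightarrow> ('a \<Rightarrow> 'b) \<Rightarrow> 'b topology" where
  "quotient_topology X q =
     topology (\<lambda>U. U \<subseteq> q ` topspace X \<and> openin X {x \<in> topspace X. q x \<in> U})"

lemma openin_quotient_topology:
  "openin (quotient_topology X q) U \<longleftrightarrow>
     U \<subseteq> q ` topspace X \<and> openin X {x \<in> topspace X. q x \<in> U}"
proof -
  have "istopology (\<lambda>U. U \<subseteq> q ` topspace X \<and> openin X {x \<in> topspace X. q x \<in> U})"
    unfolding istopology_def
  proof (intro conjI allI impI)
    fix S T
    assume "S \<subseteq> q ` topspace X \<and> openin X {x \<in> topspace X. q x \<in> S}"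
      and "T \<subseteq> q ` topspace X \<and> openin X {x \<in> topspace X. q x \<in> T}"
    moreover have "{x \<in> topspace X. q x \<in> S \<inter> T} =
        {x \<in> topspace X. q x \<in> S} \<inter> {x \<in> topspace X. q x \<in> T}"
      by auto
    ultimately show "S \<inter> T \<subseteq> q ` topspace X"
      and "openin X {x \<in> topspace X. q x \<in> S \<inter> T}"
      by (auto simp del: Int_iff)
  next
    fix \<K>
    assume *: "\<forall>U\<in>\<K>. U \<subseteq> q ` topspace X \<and> openin X {x \<in> topspace X. q x \<in> U}"
    then show "\<Union>\<K> \<subseteq> q ` topspace X"
      by blast
    have "{x \<in> topspace X. q x \<in> \<Union>\<K>} = (\<Union>U\<in>\<K>. {x \<in> topspace X. q x \<in> U})"
      by auto
    with * show "openin X {x \<in> topspace X. q x \<in> \<Union>\<K>}"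
      by auto
  qed
  then show ?thesis
    by (simp add: quotient_topology_def)
qed

lemma quotient_map_quotient_topology: "quotient_map X (quotient_topology X q) q"
proof -
  have "topspace (quotient_topology X q) = q ` topspace X"
  proof
    show "topspace (quotient_topology X q) \<subseteq> q ` topspace X"
      using openin_topspace[of "quotient_topology X q"]
      by (simp only: openin_quotient_topology)
    have "{x \<in> topspace X. q x \<in> q ` topspace X} = topspace X"
      by auto
    then have "openin (quotient_topology X q) (q ` topspace X)"
      by (simp add: openin_quotient_topology)
    then show "q ` topspace X \<subseteq> topspace (quotient_topology X q)"
      by (rule openin_subset)
  qed
  then show ?thesis
    by (simp add: quotient_map_def openin_quotient_topology)
qed

text \<open>The elements of \<open>E1 / p0 \<int>\<close> are represented as cosets, where \<open>p0 = \<kappa> *\<^sub>R eta0\<close>.\<close>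

definition coset_p0 :: "real \<Rightarrow> 'j::finite phase \<Rightarrow> 'j phase set" where
  "coset_p0 \<kappa> p = {p + of_int k *\<^sub>R (\<kappa> *\<^sub>R eta0) | k :: int. True}"

type_synonym 'j cylinder = "'j phase set \<times> 'j phase"

definition cylinder_topology :: "real \<Rightarrow> real \<Rightarrow> 'j::finite cylinder topology" where
  "cylinder_topology \<alpha> \<kappa> =
     prod_topology (quotient_topology (top_of_set E1) (coset_p0 \<kappa>)) (top_of_set (E2 \<alpha>))"

definition mod_p0 :: "real \<Rightarrow> real \<Rightarrow> 'j::finite phase \<Rightarrow> 'j cylinder" where
  "mod_p0 \<alpha> \<kappa> y = (coset_p0 \<kappa> (P_E1 \<alpha> y), Q_E2 \<alpha> y)"

text \<open>
  The set whose element is selected is a singleton, because the solution map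
  commutes with translations by integer multiples of \<open>p0\<close>.
\<close>

definition induced_map ::
  "real \<Rightarrow> real \<Rightarrow> (real \<Rightarrow> 'j noise \<Rightarrow> 'j phase \<Rightarrow> 'j phase)
     \<Rightarrow> real \<Rightarrow> 'j noise \<Rightarrow> 'j::finite cylinder \<Rightarrow> 'j cylinder" where
  "induced_map \<alpha> \<kappa> Y t \<omega> c = the_elem ((\<lambda>y. mod_p0 \<alpha> \<kappa> (Y t \<omega> y)) ` {y. mod_p0 \<alpha> \<kappa> y = c})"


section \<open>The attractor and random horizontal curves\<close>

text \<open>
  In the next three definitions \<open>nrm\<close> is the norm on the phase space and \<open>R\<close> is the
  random radius of the absorbing set. The attractor on the cylinder is the pullback
  omega-limit set of the absorbing set; the attractor on \<open>E\<close> is its lift.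
\<close>

definition absorbing_set ::
  "real \<Rightarrow> real \<Rightarrow> ('j phase \<Rightarrow> real) \<Rightarrow> ('j noise \<Rightarrow> real)
     \<Rightarrow> 'j noise \<Rightarrow> 'j::finite cylinder set" where
  "absorbing_set \<alpha> \<kappa> nrm R \<omega> = {mod_p0 \<alpha> \<kappa> y | y. nrm (Q_E2 \<alpha> y) \<le> R \<omega>}"

definition cylinder_attractor ::
  "real \<Rightarrow> real \<Rightarrow> ('j phase \<Rightarrow> real) \<Rightarrow> ('j noise \<Rightarrow> real)
     \<Rightarrow> (real \<Rightarrow> 'j noise \<Rightarrow> 'j phase \<Rightarrow> 'j phase)
     \<Rightarrow> 'j noise \<Rightarrow> 'j::finite cylinder set" where
  "cylinder_attractor \<alpha> \<kappa> nrm R Y \<omega> =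
     (\<Inter>t\<in>{0<..}. cylinder_topology \<alpha> \<kappa> closure_of
        (\<Union>\<tau>\<in>{t..}. induced_map \<alpha> \<kappa> Y \<tau> (shift (- \<tau>) \<omega>) `
           absorbing_set \<alpha> \<kappa> nrm R (shift (- \<tau>) \<omega>)))"

definition global_attractor ::
  "real \<Rightarrow> real \<Rightarrow> ('j phase \<Rightarrow> real) \<Rightarrow> ('j noise \<Rightarrow> real)
     \<Rightarrow> (real \<Rightarrow> 'j noise \<Rightarrow> 'j phase \<Rightarrow> 'j phase)
     \<Rightarrow> 'j noise \<Rightarrow> 'j::finite phase set" where
  "global_attractor \<alpha> \<kappa> nrm R Y \<omega> = {y. mod_p0 \<alpha> \<kappa> y \<in> cylinder_attractor \<alpha> \<kappa> nrm R Y \<omega>}"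

definition absorbing_radius ::
  "real \<Rightarrow> real \<Rightarrow> real^'j \<Rightarrow> real \<Rightarrow> real \<Rightarrow> real \<Rightarrow> ('j noise \<Rightarrow> real)
     \<Rightarrow> 'j::finite noise \<Rightarrow> real" where
  "absorbing_radius \<alpha> \<beta> f a c1 M1 r \<omega> =
     (let a1 = M1 * sqrt (3 * \<alpha>\<^sup>2 - 6 * \<alpha> + 4);
          a2 = M1 * sqrt (3 * (norm f)\<^sup>2 + 3 * \<beta>\<^sup>2 * c1\<^sup>2 * real CARD('j))
      in 4 * a1 / a * r \<omega> + 2 * a2 / a)"

definition random_set ::
  "'w measure \<Rightarrow> ('j::finite phase \<Rightarrow> real) \<Rightarrow> ('w \<Rightarrow> 'j phase set) \<Rightarrow> bool" where
  "random_set M nrm l \<longleftrightarrow> (\<forall>x. (\<lambda>\<omega>. INF y\<in>l \<omega>. nrm (x - y)) \<in> borel_measurable M)"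

definition random_horizontal_curve ::
  "'w measure \<Rightarrow> real \<Rightarrow> real \<Rightarrow> ('j::finite phase \<Rightarrow> real) \<Rightarrow> ('w \<Rightarrow> 'j phase set) \<Rightarrow> bool"
  where
  "random_horizontal_curve M \<alpha> \<kappa> nrm l \<longleftrightarrow>
     random_set M nrm l \<and>
     (\<exists>\<Phi>. \<forall>\<omega>\<in>space M.
        \<Phi> \<omega> ` E1 \<subseteq> E2 \<alpha> \<and>
        l \<omega> = {p + \<Phi> \<omega> p | p. p \<in> E1} \<and>
        (\<forall>p\<in>E1. \<forall>q\<in>E1. nrm (\<Phi> \<omega> p - \<Phi> \<omega> q) \<le> nrm (p - q)) \<and>
        (\<forall>p\<in>E1. \<Phi> \<omega> (p + \<kappa> *\<^sub>R eta0) = \<Phi> \<omega> p))"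

end

theory Submission
  imports Defs
begin

text \<open>
  Let \<open>L\<close> be the Lipschitz constant of the nonlinearity in the adapted norm. In that norm the linear
  part vanishes on \<open>E1\<close> and contracts \<open>E2\<close> with rate \<open>a\<close> (\<open>Lin_dissipative\<close>). This rests on the
  inequality between \<open>A\<close> and \<open>lam 1\<close> on the vectors of mean zero (\<open>spectral_gap\<close>).

  Let \<open>D\<close> be the difference of two solutions for the same noise. Since \<open>a > 2 * L\<close>, the cone in
  which the \<open>E2\<close>-part of \<open>D\<close> is dominated by its \<open>E1\<close>-part is positively invariant, and outside of
  the cone the \<open>E2\<close>-part decays like \<open>exp (- (a - 2 * L) * t)\<close> (\<open>cone_squeezing\<close>). A scalar
  comparison bounds the \<open>E2\<close>-part of a pullback solution from the absorbing set by a multiple of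
  the absorbing radius (\<open>pull_absorbed\<close>). That radius grows at most like \<open>exp (a / 2 * t)\<close> along the
  shift. Hence any two points of the pullback images at times after \<open>t\<close> lie in the cone up to an
  error of order \<open>exp (- (a / 2 - 2 * L) * t)\<close> (\<open>tail_squeezing\<close>), and this tends to \<open>0\<close> since
  \<open>a > 4 * L\<close>.

  The projection onto the cylinder is continuous and open, so the attractor on \<open>E\<close> is the pullback
  limit set computed in \<open>E\<close> (\<open>global_attractor_eq\<close>). By the estimate above any two of its points
  lie in the cone (\<open>limit_set_in_cone\<close>), so it is a graph over a part of \<open>E1\<close> with Lipschitz
  constant \<open>1\<close>. Every point of \<open>E1\<close> is covered (\<open>limit_set_point\<close>): the pullback image of the line
  \<open>E1\<close> meets every fibre by the intermediate value theorem, because the solution map commutes with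
  translations by \<open>p0\<close>, and the points obtained for the times \<open>0, 1, 2, \<dots>\<close> form a Cauchy sequence.

  For measurability, the distance to the attractor is the pointwise limit of the distances to the
  pullback images of \<open>E1\<close> (\<open>random_limit_set\<close>). Solutions depend measurably on the noise because
  they are limits of Euler schemes (\<open>solution_measurable\<close>).
\<close>


section \<open>The spectral gap\<close>

lemma linear_coefficient_zero:
  fixes b c :: real
  assumes "\<And>t. 0 \<le> 2 * t * b + t\<^sup>2 * c"
  shows "b = 0"
proof (rule ccontr)
  assume b: "b \<noteq> 0"
  define d where "d = \<bar>c\<bar> + 1"
  have d: "d > 0" "c < d" by (auto simp: d_def)
  have "0 \<le> 2 * (- b / d) * b + (- b / d)\<^sup>2 * c" by (rule assms)
  also have "\<dots> = b\<^sup>2 / d\<^sup>2 * (c - 2 * d)"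
    using d by (simp add: field_simps power2_eq_square)
  also have "\<dots> < 0"
    using b d by (intro mult_pos_neg) auto
  finally show False by simp
qed

lemma symmetric_matrix_inner:
  fixes A :: "real^'j^'j"
  assumes "transpose A = A"
  shows "(A *v x) \<bullet> y = x \<bullet> (A *v y)"
  by (metis assms dot_lmul_matrix vector_transpose_matrix)

lemma det_eigenvalue_zero:
  fixes A :: "real^'j^'j::finite"
  assumes "A *v x = \<mu> *\<^sub>R x" "x \<noteq> 0"
  shows "det (mat \<mu> - A) = 0"
proof -
  have "mat \<mu> *v x = \<mu> *\<^sub>R x"
    by (simp add: vec_eq_iff mat_def matrix_vector_mult_def if_distrib[of "\<lambda>a. a * b" for b] cong:
        if_cong)
  then have "(mat \<mu> - A) *v x = 0"
    using assms by (simp add: matrix_vector_mult_diff_rdistrib)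
  then have "\<not> invertible (mat \<mu> - A)"
    using assms(2) by (metis invertible_def matrix_left_invertible_ker)
  then show ?thesis
    by (simp add: invertible_det_nz)
qed

text \<open>
  The matrix \<open>S\<close> below is the identity with the rows \<open>i\<close> and \<open>k\<close> replaced by two independent
  kernel vectors. In the product of \<open>S\<close> with \<open>mat x - A\<close> these two rows become multiples of
  \<open>x\<close>, so that \<open>x\<^sup>2\<close> divides the characteristic polynomial.
\<close>

lemma charpoly_double_zero:
  fixes A :: "real^'j^'j::finite"
  assumes sym: "transpose A = A" and ker1: "A *v vec 1 = 0" and kerw: "A *v w = 0"
    and orth: "w \<bullet> vec 1 = 0" and "w \<noteq> 0"
  obtains T :: "real \<Rightarrow> real^'j^'j" and s :: real where "s \<noteq> 0"
    and "\<And>x. s * det (mat x - A) = x\<^sup>2 * det (T x)" and "continuous_on UNIV (\<lambda>x. det (T x))"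
proof -
  have "\<exists>i k. w $ i \<noteq> w $ k"
  proof (rule ccontr)
    assume "\<not> ?thesis"
    then have const: "w $ p = w $ i" for p i by simp
    have "w \<bullet> vec 1 = real CARD('j) * w $ i" for i
    proof -
      have "w \<bullet> vec 1 = (\<Sum>p\<in>UNIV. w $ p)" by (simp add: inner_vec_def)
      also have "\<dots> = (\<Sum>p\<in>(UNIV :: 'j set). w $ i)" by (intro sum.cong refl const)
      finally show ?thesis by simp
    qed
    then have "w $ i = 0" for i using orth by (metis mult_eq_0_iff of_nat_eq_0_iff
        zero_less_card_finite less_numeral_extra(3))
    then show False using \<open>w \<noteq> 0\<close> by (simp add: vec_eq_iff)
  qed
  then obtain i k where ik: "w $ i \<noteq> w $ k" by blast
  then have "i \<noteq> k" by auto
  define S :: "real^'j^'j" where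
    "S = (\<chi> p. if p = i then vec 1 else if p = k then w else axis p 1)"
  define T :: "real \<Rightarrow> real^'j^'j" where
    "T x = (\<chi> p. if p = i then vec 1 else if p = k then w else row p (mat x - A))" for x
  define c :: "real \<Rightarrow> 'j \<Rightarrow> real" where "c x p = (if p = i \<or> p = k then x else 1)" for x p
  have dS: "det S \<noteq> 0"
  proof -
    have "y = 0" if y: "transpose S *v y = 0" for y
    proof -
      have e: "(\<Sum>p\<in>UNIV. S $ p $ q * y $ p) = 0" for q
        using y by (simp add: vec_eq_iff matrix_vector_mult_def transpose_def)
      have split: "(\<Sum>p\<in>UNIV. S $ p $ q * y $ p) = y $ i + w $ q * y $ k + (if q = i \<or> q = k then 0
          else y $ q)" for q
      proof -
        have U: "UNIV = insert i (insert k (UNIV - {i, k}))" by auto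
        have "(\<Sum>p\<in>UNIV. S $ p $ q * y $ p) = y $ i + w $ q * y $ k + (\<Sum>p\<in>UNIV - {i, k}. S $ p $ q
            * y $ p)"
          using \<open>i \<noteq> k\<close> by (subst U) (simp add: S_def)
        also have "(\<Sum>p\<in>UNIV - {i, k}. S $ p $ q * y $ p) = (\<Sum>p\<in>UNIV - {i, k}. if p = q then y $ p
            else 0)"
          by (rule sum.cong) (auto simp: S_def axis_def)
        also have "\<dots> = (if q = i \<or> q = k then 0 else y $ q)"
          by (subst sum.delta) auto
        finally show ?thesis .
      qed
      have "y $ i + w $ i * y $ k = 0" "y $ i + w $ k * y $ k = 0"
        using e[of i] e[of k] split[of i] split[of k] by auto
      then have "(w $ i - w $ k) * y $ k = 0" by argo
      then have yk: "y $ k = 0" using ik by simp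
      then have yi: "y $ i = 0" using \<open>y $ i + w $ i * y $ k = 0\<close> by simp
      have "y $ q = 0" for q using e[of q] split[of q] yk yi by (cases "q = i \<or> q = k") auto
      then show ?thesis by (simp add: vec_eq_iff)
    qed
    then have "invertible (transpose S)"
      by (metis invertible_left_inverse matrix_left_invertible_ker)
    then show ?thesis by (simp add: invertible_det_nz det_transpose)
  qed
  have prod: "S ** (mat x - A) = (\<chi> p. c x p *s T x $ p)" for x
  proof -
    have row: "(S ** (mat x - A)) $ p = transpose (mat x - A) *v (S $ p)" for p
      by (simp add: vec_eq_iff matrix_matrix_mult_def matrix_vector_mult_def transpose_def
          mult.commute)
    have t: "transpose (mat x - A) = mat x - A"
      using sym by (simp add: vec_eq_iff transpose_def mat_def)
    have m: "mat x *v y = x *s y" for y :: "real^'j"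
      by (simp add: vec_eq_iff mat_def matrix_vector_mult_def if_distrib[of "\<lambda>a. a * b" for b]
          cong: if_cong)
    have ax: "(mat x - A) *v axis p 1 = row p (mat x - A)" for p
      by (metis t matrix_vector_mul_component matrix_vector_mult_basis row_transpose column_def
          row_def)
    have "(S ** (mat x - A)) $ p = c x p *s T x $ p" for p
    proof -
      consider "p = i" | "p = k" "p \<noteq> i" | "p \<noteq> i" "p \<noteq> k" by blast
      then show ?thesis
      proof cases
        case 1
        then have "S $ p = vec 1" "T x $ p = vec 1" "c x p = x" by (auto simp: S_def T_def c_def)
        then show ?thesis by (simp only: row t matrix_vector_mult_diff_rdistrib m ker1) simp
      next
        case 2
        then have "S $ p = w" "T x $ p = w" "c x p = x" by (auto simp: S_def T_def c_def)
        then show ?thesis by (simp only: row t matrix_vector_mult_diff_rdistrib m kerw) simp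
      next
        case 3
        then have "S $ p = axis p 1" "T x $ p = row p (mat x - A)" "c x p = 1"
          by (auto simp: S_def T_def c_def)
        then show ?thesis by (simp only: row t ax) simp
      qed
    qed
    then show ?thesis by (simp add: vec_eq_iff)
  qed
  have "det S * det (mat x - A) = x\<^sup>2 * det (T x)" for x
  proof -
    have "det S * det (mat x - A) = det (S ** (mat x - A))" by (simp add: det_mul)
    also have "\<dots> = prod (c x) UNIV * det (T x)"
      unfolding prod by (subst det_rows_mul) (simp add: vec_lambda_eta)
    also have "prod (c x) UNIV = x\<^sup>2"
    proof -
      have U: "UNIV = insert i (insert k (UNIV - {i, k}))" by auto
      show ?thesis using \<open>i \<noteq> k\<close> by (subst U) (simp add: c_def power2_eq_square)
    qed
    finally show ?thesis .
  qed
  moreover have "continuous_on UNIV (\<lambda>x. det (T x))"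
  proof -
    have "continuous_on UNIV (\<lambda>x. T x $ p $ q)" for p q
      by (cases "p = i"; cases "p = k"; cases "p = q") (auto simp: T_def row_def mat_def intro!:
          continuous_intros)
    then show ?thesis unfolding det_def
      by (intro continuous_on_sum continuous_on_mult continuous_on_const continuous_on_prod)
  qed
  ultimately show ?thesis using that dS by blast
qed

text \<open>
  The minimum \<open>\<mu>\<close> of the quadratic form on the unit sphere of the orthogonal complement of the
  constants is an eigenvalue. It is not \<open>lam 0\<close>, since that zero of the characteristic
  polynomial is simple.
\<close>

lemma spectral_gap:
  fixes A :: "real^'j^'j::finite"
  assumes sym: "transpose A = A" and pos: "\<forall>x. 0 \<le> (A *v x) \<bullet> x"
    and spec: "simple_zero_spectrum A lam" and ker: "A *v vec 1 = 0" and card: "2 \<le> CARD('j)"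
    and u: "u \<bullet> vec 1 = 0"
  shows "lam 1 * (u \<bullet> u) \<le> (A *v u) \<bullet> u"
proof -
  define S where "S = {x :: real^'j. x \<bullet> vec 1 = 0 \<and> norm x = 1}"
  note symi = symmetric_matrix_inner[OF sym]
  have S_eq: "S = {x. x \<bullet> vec 1 = 0} \<inter> sphere 0 1" by (auto simp: S_def)
  have "compact S" unfolding S_eq
    by (intro closed_Int_compact closed_Collect_eq continuous_intros compact_sphere)
  show ?thesis
  proof (cases "u = 0")
    case False
    then have "u /\<^sub>R norm u \<in> S" using u by (auto simp: S_def)
    then have "S \<noteq> {}" by blast
    have "continuous_on S (\<lambda>x. (A *v x) \<bullet> x)"
      by (intro continuous_intros linear_continuous_on matrix_vector_mul_bounded_linear)
    then obtain w where w: "w \<in> S" "\<And>y. y \<in> S \<Longrightarrow> (A *v w) \<bullet> w \<le> (A *v y) \<bullet> y"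
      using continuous_attains_inf[OF \<open>compact S\<close> \<open>S \<noteq> {}\<close>] by blast
    define \<mu> where "\<mu> = (A *v w) \<bullet> w"
    have ww: "w \<bullet> w = 1" "w \<bullet> vec 1 = 0" "w \<noteq> 0" using w(1) by (auto simp: S_def dot_square_norm)
    have min: "\<mu> * (y \<bullet> y) \<le> (A *v y) \<bullet> y" if y: "y \<bullet> vec 1 = 0" for y
    proof (cases "y = 0")
      case False
      then have "y /\<^sub>R norm y \<in> S" using y by (auto simp: S_def)
      from w(2)[OF this] have "\<mu> \<le> ((A *v y) \<bullet> y) / (norm y)\<^sup>2"
        by (simp add: \<mu>_def matrix_vector_mult_scaleR power2_eq_square divide_simps)
      then show ?thesis using False by (simp add: field_simps dot_square_norm)
    qed simp
    have eig: "A *v w = \<mu> *\<^sub>R w"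
    proof -
      define h where "h = A *v w - \<mu> *\<^sub>R w"
      have h: "h \<bullet> vec 1 = 0"
        using ww using ker by (simp add: h_def inner_diff_left symi)
      have "0 \<le> 2 * t * (h \<bullet> h) + t\<^sup>2 * ((A *v h) \<bullet> h - \<mu> * (h \<bullet> h))" for t
      proof -
        have "\<mu> * ((w + t *\<^sub>R h) \<bullet> (w + t *\<^sub>R h)) \<le> (A *v (w + t *\<^sub>R h)) \<bullet> (w + t *\<^sub>R h)"
          by (rule min) (use ww h in \<open>simp add: inner_add_left\<close>)
        moreover have "(A *v h) \<bullet> w = (A *v w) \<bullet> h" by (metis symi inner_commute)
        moreover have "(A *v w) \<bullet> h = h \<bullet> h + \<mu> * (w \<bullet> h)"
          by (subst (2) h_def) (simp add: inner_diff_left)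
        ultimately show ?thesis
          by (simp add: matrix_vector_right_distrib matrix_vector_mult_scaleR inner_add_left
              inner_add_right
              inner_commute[of h w] ww \<mu>_def[symmetric] power2_eq_square algebra_simps)
      qed
      then have "h \<bullet> h = 0" by (rule linear_coefficient_zero)
      then show ?thesis by (simp add: h_def)
    qed
    have char: "det (mat x - A) = (\<Prod>i<CARD('j). x - lam i)" for x
      using spec by (simp add: simple_zero_spectrum_def)
    have lam0: "lam 0 = 0" and lam1: "0 < lam 1"
      and mono: "\<And>i k. 1 \<le> i \<Longrightarrow> i \<le> k \<Longrightarrow> k < CARD('j) \<Longrightarrow> lam i \<le> lam k"
      using spec by (auto simp: simple_zero_spectrum_def)
    have "(\<Prod>i<CARD('j). \<mu> - lam i) = 0"
      using det_eigenvalue_zero[OF eig ww(3)] char by simp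
    then obtain i where i: "i < CARD('j)" "\<mu> = lam i" by auto
    have "i \<noteq> 0"
    proof
      assume "i = 0"
      then have "A *v w = 0" using i lam0 eig by simp
      then obtain T s where s: "s \<noteq> 0"
        and T: "\<And>x. s * det (mat x - A) = x\<^sup>2 * det (T x)"
        and cont: "continuous_on UNIV (\<lambda>x. det (T x :: real^'j^'j))"
        using charpoly_double_zero[OF sym ker _ ww(2,3)] by metis
      define p where "p x = (\<Prod>i\<in>{1..<CARD('j)}. x - lam i)" for x
      have fac: "det (mat x - A) = x * p x" for x
      proof -
        have "{..<CARD('j)} = insert 0 {1..<CARD('j)}" using card by auto
        then show ?thesis by (simp add: char p_def lam0)
      qed
      have eq: "s * p x = x * det (T x)" if "x \<noteq> 0" for x
        using T[of x] that by (simp add: fac power2_eq_square)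
      have "((\<lambda>x. s * p x) \<longlongrightarrow> s * p 0) (at 0)"
        unfolding p_def by (intro tendsto_intros)
      moreover have "((\<lambda>x. x * det (T x)) \<longlongrightarrow> 0 * det (T 0)) (at 0)"
        using cont by (intro tendsto_intros) (simp add: continuous_on_eq_continuous_at isCont_def)
      then have "((\<lambda>x. x * det (T x)) \<longlongrightarrow> 0) (at 0)" by simp
      then have "((\<lambda>x. s * p x) \<longlongrightarrow> 0) (at 0)"
        by (rule tendsto_cong[THEN iffD1, rotated]) (auto simp: eventually_at_filter eq)
      ultimately have "s * p 0 = 0" using tendsto_unique trivial_limit_at by blast
      then obtain m where "1 \<le> m" "m < CARD('j)" "lam m = 0"
        using s by (auto simp: p_def)
      then show False using mono[of 1 m] lam1 by simp
    qed
    then have "lam 1 \<le> \<mu>" using mono[of 1 i] i by simp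
    then have "lam 1 * (u \<bullet> u) \<le> \<mu> * (u \<bullet> u)" by (rule mult_right_mono) simp
    also have "\<dots> \<le> (A *v u) \<bullet> u" by (rule min[OF u])
    finally show ?thesis .
  qed simp
qed


section \<open>The splitting of the phase space in coordinates\<close>

text \<open>The mean of a vector, and its component orthogonal to the constant vectors.\<close>

definition avg :: "real^'j::finite \<Rightarrow> real" where
  "avg u = (\<Sum>i\<in>UNIV. u $ i) / real CARD('j)"

definition fluct :: "real^'j::finite \<Rightarrow> real^'j" where
  "fluct u = u - vec (avg u)"

lemma avg_simps [simp]:
  "avg (vec c :: real^'j::finite) = c" "avg (0 :: real^'j) = 0" "avg (1 :: real^'j) = 1"
  "avg (u + v :: real^'j) = avg u + avg v" "avg (u - v :: real^'j) = avg u - avg v"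
  "avg (- u :: real^'j) = - avg u" "avg (t *\<^sub>R u :: real^'j) = t * avg u"
  by (simp_all add: avg_def sum.distrib sum_subtractf sum_negf add_divide_distrib
      diff_divide_distrib sum_distrib_left)

lemma inner_vec_const:
  fixes u :: "real^'j::finite"
  shows "u \<bullet> vec c = real CARD('j) * c * avg u" "vec c \<bullet> u = real CARD('j) * c * avg u"
  by (simp_all add: avg_def inner_vec_def sum_distrib_left[symmetric] sum_distrib_right[symmetric])

lemma fluct_simps [simp]:
  "fluct (vec c :: real^'j::finite) = 0" "fluct (0 :: real^'j) = 0"
  "fluct (u + v :: real^'j) = fluct u + fluct v" "fluct (u - v :: real^'j) = fluct u - fluct v"
  "fluct (- u :: real^'j) = - fluct u" "fluct (t *\<^sub>R u :: real^'j) = t *\<^sub>R fluct u"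
  "avg (fluct u) = 0" "fluct (fluct u) = fluct u"
  by (simp_all add: fluct_def vec_eq_iff algebra_simps)

lemma inner_fluct:
  fixes u v :: "real^'j::finite"
  shows "u \<bullet> v = fluct u \<bullet> fluct v + real CARD('j) * avg u * avg v"
proof -
  have "u = fluct u + vec (avg u)" "v = fluct v + vec (avg v)" by (auto simp: fluct_def)
  then have "u \<bullet> v = (fluct u + vec (avg u)) \<bullet> (fluct v + vec (avg v))" by simp
  then show ?thesis by (simp add: inner_add_left inner_add_right inner_vec_const)
qed

lemma scaleR_vec: "t *\<^sub>R (vec c :: real^'j) = vec (t * c)"
  by (simp add: vec_eq_iff)

lemma E1_eq: "(E1 :: 'j::finite phase set) = {(vec c, 0) | c. True}"
  by (auto simp: E1_def eta0_def span_singleton scaleR_vec[of _ 1, simplified])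

lemma E_m1_eq: "(E_m1 \<alpha> :: 'j::finite phase set) = {(vec c, vec (- \<alpha> * c)) | c. True}"
  by (auto simp: E_m1_def eta_m1_def span_singleton scaleR_vec scaleR_vec[of _ 1, simplified]
      mult.commute)

lemma E11_eq:
  assumes "\<alpha> \<noteq> 0"
  shows "(E11 \<alpha> :: 'j::finite phase set) = {(vec c, vec d) | c d. True}"
proof
  show "(E11 \<alpha> :: 'j phase set) \<subseteq> {(vec c, vec d) | c d. True}"
    by (auto simp: E11_def E1_eq E_m1_eq vec_add[symmetric])
  show "{(vec c, vec d) | c d. True} \<subseteq> (E11 \<alpha> :: 'j phase set)"
  proof clarify
    fix c d :: real
    have "(vec c, vec d) = (vec (c + d / \<alpha>), 0 :: real^'j) + (vec (- d / \<alpha>), vec (- \<alpha> * (- d / \<alpha>)))"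
      using assms by (simp add: vec_eq_iff)
    then show "(vec c :: real^'j, vec d :: real^'j) \<in> E11 \<alpha>"
      unfolding E11_def E1_eq E_m1_eq by blast
  qed
qed

lemma E22_eq:
  assumes "\<alpha> \<noteq> 0"
  shows "(E22 \<alpha> :: 'j::finite phase set) = {(u, v). avg u = 0 \<and> avg v = 0}"
proof -
  have "(u, v) \<in> (E22 \<alpha> :: 'j phase set) \<longleftrightarrow> (\<forall>c d. c * avg u + d * avg v = 0)" for u v
  proof -
    have "(u, v) \<in> (E22 \<alpha> :: 'j phase set) \<longleftrightarrow> (\<forall>c d. (vec c, vec d) \<bullet> (u, v) = 0)"
      by (auto simp: E22_def orthogonal_comp_def orthogonal_def E11_eq[OF assms])
    also have "\<dots> \<longleftrightarrow> (\<forall>c d. real CARD('j) * (c * avg u + d * avg v) = 0)"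
      by (simp add: inner_vec_const algebra_simps)
    finally show ?thesis by simp
  qed
  moreover have "(\<forall>c d. c * avg u + d * avg v = 0) \<longleftrightarrow> avg u = 0 \<and> avg v = 0"
    for u v :: "real^'j"
    by (metis add_cancel_right_right mult_cancel_right1 mult_zero_left mult_zero_right)
  ultimately show ?thesis by auto
qed

text \<open>
  The coordinate of the projection on \<open>E1\<close> along \<open>E2\<close>: this projection sends \<open>y\<close> to
  \<open>(vec (phase_coord \<alpha> y), 0)\<close>.
\<close>

definition phase_coord :: "real \<Rightarrow> 'j::finite phase \<Rightarrow> real" where
  "phase_coord \<alpha> y = avg (fst y) + avg (snd y) / \<alpha>"

lemma phase_coord_simps [simp]:
  "phase_coord \<alpha> (x + y) = phase_coord \<alpha> x + phase_coord \<alpha> y"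
  "phase_coord \<alpha> (x - y) = phase_coord \<alpha> x - phase_coord \<alpha> y"
  "phase_coord \<alpha> (- y) = - phase_coord \<alpha> y"
  "phase_coord \<alpha> (t *\<^sub>R y) = t * phase_coord \<alpha> y"
  "phase_coord \<alpha> (vec c, 0) = c"
  "phase_coord \<alpha> 0 = 0"
  by (simp_all add: phase_coord_def add_divide_distrib diff_divide_distrib algebra_simps)

lemma linear_phase_coord: "linear (phase_coord \<alpha>)"
  by (rule linearI) simp_all

lemma continuous_on_phase_coord [continuous_intros]:
  "continuous_on S f \<Longrightarrow> continuous_on S (\<lambda>x. phase_coord \<alpha> (f x))"
  by (rule bounded_linear.continuous_on[OF linear_conv_bounded_linear[THEN iffD1, OF
      linear_phase_coord]])

lemma E2_eq:
  assumes "\<alpha> \<noteq> 0"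
  shows "(E2 \<alpha> :: 'j::finite phase set) = {y. phase_coord \<alpha> y = 0}"
proof
  show "(E2 \<alpha> :: 'j phase set) \<subseteq> {y. phase_coord \<alpha> y = 0}"
    using assms by (auto simp: E2_def E_m1_eq E22_eq phase_coord_def)
  show "{y. phase_coord \<alpha> y = 0} \<subseteq> (E2 \<alpha> :: 'j phase set)"
  proof clarify
    fix u v :: "real^'j" assume "phase_coord \<alpha> (u, v) = 0"
    then have "avg v = - \<alpha> * avg u" using assms by (simp add: phase_coord_def field_simps)
    then have "(u, v) = (vec (avg u), vec (- \<alpha> * avg u)) + (fluct u, fluct v)"
      by (simp add: fluct_def)
    moreover have "(fluct u, fluct v) \<in> E22 \<alpha>" by (simp add: E22_eq[OF assms])
    ultimately show "(u, v) \<in> E2 \<alpha>" unfolding E2_def E_m1_eq by blast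
  qed
qed

lemma P_E1_eq:
  assumes "\<alpha> \<noteq> 0"
  shows "P_E1 \<alpha> y = (vec (phase_coord \<alpha> y), 0 :: real^'j::finite)"
  unfolding P_E1_def proj_along_def
proof (rule the_equality)
  show "(vec (phase_coord \<alpha> y), 0) \<in> E1 \<and> y - (vec (phase_coord \<alpha> y), 0) \<in> E2 \<alpha>"
    by (auto simp: E1_eq E2_eq[OF assms])
next
  fix p assume "p \<in> E1 \<and> y - p \<in> E2 \<alpha>"
  then show "p = (vec (phase_coord \<alpha> y), 0)"
    by (auto simp: E1_eq E2_eq[OF assms])
qed

lemma proj_E11:
  assumes "\<alpha> \<noteq> 0"
  shows "proj_along (E11 \<alpha>) (E22 \<alpha>) (u, v) = (vec (avg u), vec (avg v) :: real^'j::finite)"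
  unfolding proj_along_def
  by (rule the_equality) (auto simp: E11_eq[OF assms] E22_eq[OF assms])

lemma proj_E22:
  assumes "\<alpha> \<noteq> 0"
  shows "proj_along (E22 \<alpha>) (E11 \<alpha>) (u, v) = (fluct u, fluct v :: real^'j::finite)"
  unfolding proj_along_def
proof (rule the_equality)
  have "(u, v) - (fluct u, fluct v) = (vec (avg u), vec (avg v))" by (simp add: fluct_def)
  then show "(fluct u, fluct v) \<in> E22 \<alpha> \<and> (u, v) - (fluct u, fluct v) \<in> E11 \<alpha>"
    by (auto simp: E11_eq[OF assms] E22_eq[OF assms])
next
  fix p assume "p \<in> E22 \<alpha> \<and> (u, v) - p \<in> E11 \<alpha>"
  then obtain c d where p: "avg (fst p) = 0" "avg (snd p) = 0" "u = fst p + vec c" "v = snd p +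
      vec d"
    by (cases p) (auto simp: E11_eq[OF assms] E22_eq[OF assms] algebra_simps)
  then show "p = (fluct u, fluct v)" by (cases p) (auto simp: fluct_def)
qed


section \<open>The adapted norm and the linear part\<close>

lemma bilinear_cauchy_schwarz:
  fixes B :: "'a::real_vector \<Rightarrow> 'a \<Rightarrow> real"
  assumes bil: "bilinear B" and sym: "\<And>x y. B x y = B y x" and pos: "\<And>x. 0 \<le> B x x"
  shows "\<bar>B x y\<bar> \<le> sqrt (B x x) * sqrt (B y y)"
proof -
  have expand: "0 \<le> B x x + 2 * t * B x y + t\<^sup>2 * B y y" for t
  proof -
    have "0 \<le> B (x + t *\<^sub>R y) (x + t *\<^sub>R y)" by (rule pos)
    also have "\<dots> = B x x + 2 * t * B x y + t\<^sup>2 * B y y"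
      by (simp add: bilinear_ladd[OF bil] bilinear_radd[OF bil] bilinear_lmul[OF bil]
          bilinear_rmul[OF bil] sym[of y x] power2_eq_square algebra_simps)
    finally show ?thesis .
  qed
  have "(B x y)\<^sup>2 \<le> B x x * B y y"
  proof (cases "B y y = 0")
    case True
    have "B x y = 0"
    proof (rule ccontr)
      assume nz: "B x y \<noteq> 0"
      then have "2 * (- (B x x + 1) / (2 * B x y)) * B x y = - (B x x + 1)" by simp
      with expand[of "- (B x x + 1) / (2 * B x y)"] show False
        using True by simp
    qed
    then show ?thesis using True by simp
  next
    case False
    then have p: "B y y > 0" using pos[of y] by simp
    have "0 \<le> B x x + 2 * (- B x y / B y y) * B x y + (- B x y / B y y)\<^sup>2 * B y y"
      by (rule expand)
    also have "\<dots> = (B x x * B y y - (B x y)\<^sup>2) / B y y"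
      using p by (simp add: field_simps power2_eq_square)
    finally show ?thesis using p by (simp add: zero_le_divide_iff)
  qed
  then have "sqrt ((B x y)\<^sup>2) \<le> sqrt (B x x * B y y)" by (rule real_sqrt_le_mono)
  then show ?thesis by (simp add: real_sqrt_mult)
qed

text \<open>The constants of the linear part, with the spectral gap of \<open>A\<close> in variational form.\<close>

locale adapted_form =
  fixes A :: "real^'j^'j::finite" and \<alpha> K \<delta> lam1 :: real
  assumes alpha: "0 < \<alpha>" and K_pos: "0 < K" and delta: "0 < \<delta>" "\<delta> \<le> 1" and lam1: "0 < lam1"
    and sym: "transpose A = A" and ker: "A *v vec 1 = 0"
    and gap: "\<And>u. u \<bullet> vec 1 = 0 \<Longrightarrow> lam1 * (u \<bullet> u) \<le> (A *v u) \<bullet> u"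
begin

abbreviation B :: "'j phase \<Rightarrow> 'j phase \<Rightarrow> real" where "B \<equiv> inner_E A \<alpha> K \<delta> lam1"
abbreviation nrm :: "'j phase \<Rightarrow> real" where "nrm \<equiv> norm_E A \<alpha> K \<delta> lam1"
abbreviation P :: "'j phase \<Rightarrow> 'j phase" where "P \<equiv> P_E1 \<alpha>"
abbreviation Q :: "'j phase \<Rightarrow> 'j phase" where "Q \<equiv> Q_E2 \<alpha>"
abbreviation coord :: "'j phase \<Rightarrow> real" where "coord \<equiv> phase_coord \<alpha>"

text \<open>The contraction rate of the linear part on \<open>E2\<close>.\<close>

definition rate :: real where "rate = \<alpha> / 2 - \<bar>\<alpha> / 2 - \<delta> * K * lam1 / \<alpha>\<bar>"

text \<open>The linear part of the vector field.\<close>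

definition Lin :: "'j phase \<Rightarrow> 'j phase" where
  "Lin = (\<lambda>(u, v). (v, - (K *\<^sub>R (A *v u)) - \<alpha> *\<^sub>R v))"

lemma alpha_nz: "\<alpha> \<noteq> 0" using alpha by simp

lemma P_eq: "P y = (vec (coord y), 0)" by (rule P_E1_eq[OF alpha_nz])
lemma Q_eq: "Q y = y - (vec (coord y), 0)" by (simp add: Q_E2_def P_eq)

lemma coord_P [simp]: "coord (P y) = coord y" and coord_Q [simp]: "coord (Q y) = 0"
  by (simp_all add: P_eq Q_eq)

lemma PQ: "P y + Q y = y" by (simp add: P_eq Q_eq)

lemma P_diff: "P (x - y) = P x - P y" by (simp add: P_eq vec_eq_iff)
lemma Q_diff: "Q (x - y) = Q x - Q y" by (simp add: Q_E2_def P_diff)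

lemma linear_Q: "linear Q"
  by (rule linearI) (auto simp: Q_eq vec_eq_iff prod_eq_iff algebra_simps)

lemma A_vec [simp]: "A *v vec c = 0"
proof -
  have "A *v vec c = A *v (c *\<^sub>R vec 1)" by (simp add: scaleR_vec del: vec_1)
  then show ?thesis by (simp add: matrix_vector_mult_scaleR ker del: vec_1)
qed

lemma A_inner: "(A *v x) \<bullet> y = (A *v y) \<bullet> x"
  by (metis symmetric_matrix_inner[OF sym] inner_commute)

lemma A_fluct: "A *v fluct u = A *v u"
  by (simp add: fluct_def matrix_vector_mult_diff_distrib)

lemma A_avg [simp]: "avg (A *v u) = 0"
proof -
  have "(A *v u) \<bullet> vec 1 = 0" using A_inner[of u "vec 1"] by (simp add: ker del: vec_1)
  then show ?thesis by (simp add: inner_vec_const del: vec_1)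
qed

lemma A_inner_fluct: "(A *v u) \<bullet> fluct v = (A *v u) \<bullet> v"
  by (simp add: fluct_def inner_diff_right inner_vec_const)

lemma gap_fluct: "lam1 * (fluct u \<bullet> fluct u) \<le> (A *v u) \<bullet> u"
  using gap[of "fluct u"] by (simp add: inner_vec_const A_fluct A_inner_fluct del: vec_1)

lemma gap_fluct': "\<delta> * K * lam1 * (fluct u \<bullet> fluct u) \<le> K * ((A *v u) \<bullet> u)"
proof -
  have "\<delta> * (K * lam1 * (fluct u \<bullet> fluct u)) \<le> 1 * (K * lam1 * (fluct u \<bullet> fluct u))"
    using delta K_pos lam1 by (intro mult_right_mono mult_nonneg_nonneg) auto
  also have "\<dots> \<le> K * ((A *v u) \<bullet> u)"
    using K_pos gap_fluct[of u] by (simp add: mult.assoc)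
  finally show ?thesis by (simp add: mult.assoc)
qed

text \<open>
  The adapted form in coordinates. The parts on \<open>E11\<close> and \<open>E22\<close> differ only by the term in \<open>A\<close>, which
  vanishes on constants, and by the term in \<open>lam1\<close>, in which only the fluctuations enter.
\<close>

lemma B_eq:
  "B (u1, v1) (u2, v2) = \<alpha>\<^sup>2 / 4 * (u1 \<bullet> u2) + ((\<alpha> / 2) *\<^sub>R u1 + v1) \<bullet> ((\<alpha> / 2) *\<^sub>R u2 + v2)
     + K * ((A *v u1) \<bullet> u2) - \<delta> * K * lam1 * (fluct u1 \<bullet> fluct u2)"
  unfolding inner_E_def proj_E11[OF alpha_nz] proj_E22[OF alpha_nz] inner_E11_def inner_E22_def
  by (simp add: A_fluct A_inner_fluct inner_fluct[of u1 u2] inner_fluct[of u1 v2] inner_fluct[of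
      v1 u2] inner_fluct[of v1 v2]
      inner_add_left inner_add_right inner_vec_const algebra_simps)

lemma B_sym: "B x y = B y x"
proof -
  obtain u1 v1 u2 v2 where xy: "x = (u1, v1)" "y = (u2, v2)" by (cases x; cases y)
  show ?thesis
    unfolding xy B_eq A_inner[of u1 u2] by (simp only: inner_commute)
qed

lemma bilinear_B: "bilinear B"
proof -
  have "linear (B x)" for x
    by (cases x, rule linearI)
      (auto simp: B_eq inner_add_right inner_add_left scaleR_add_right algebra_simps)
  moreover then have "linear (\<lambda>x. B x y)" for y
    by (simp add: B_sym[of _ y])
  ultimately show ?thesis by (simp add: bilinear_def)
qed

lemma bounded_bilinear_B: "bounded_bilinear B"
  using bilinear_B by (simp add: bilinear_conv_bounded_bilinear)

lemma B_lower: "\<alpha>\<^sup>2 / 4 * (norm u)\<^sup>2 + (norm ((\<alpha> / 2) *\<^sub>R u + v))\<^sup>2 \<le> B (u, v) (u, v)"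
  using gap_fluct'[of u] by (simp add: B_eq power2_norm_eq_inner)

lemma B_nonneg: "0 \<le> B y y"
proof -
  have "0 \<le> \<alpha>\<^sup>2 / 4 * (norm (fst y))\<^sup>2 + (norm ((\<alpha> / 2) *\<^sub>R fst y + snd y))\<^sup>2" by simp
  also have "\<dots> \<le> B y y" using B_lower[of "fst y" "snd y"] by simp
  finally show ?thesis .
qed

lemma nrm_sq: "(nrm y)\<^sup>2 = B y y" by (simp add: norm_E_def B_nonneg)
lemma nrm_nonneg [simp]: "0 \<le> nrm y" by (simp add: norm_E_def B_nonneg)

lemma B_cs: "\<bar>B x y\<bar> \<le> nrm x * nrm y"
  unfolding norm_E_def by (rule bilinear_cauchy_schwarz[OF bilinear_B B_sym B_nonneg])

lemmas B_add = bilinear_ladd[OF bilinear_B] bilinear_radd[OF bilinear_B]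
lemmas B_diff = bilinear_lsub[OF bilinear_B] bilinear_rsub[OF bilinear_B]
lemmas B_scale = bilinear_lmul[OF bilinear_B] bilinear_rmul[OF bilinear_B]

lemma nrm_scale: "nrm (t *\<^sub>R y) = \<bar>t\<bar> * nrm y"
  by (simp add: norm_E_def B_scale real_sqrt_mult mult.assoc[symmetric])

lemma nrm_minus [simp]: "nrm (- y) = nrm y" using nrm_scale[of "-1" y] by simp
lemma nrm_zero [simp]: "nrm 0 = 0" using nrm_scale[of 0 0] by simp
lemma nrm_commute: "nrm (x - y) = nrm (y - x)" using nrm_minus[of "x - y"] by simp

lemma nrm_triangle: "nrm (x + y) \<le> nrm x + nrm y"
proof (rule power2_le_imp_le)
  have "(nrm (x + y))\<^sup>2 = (nrm x)\<^sup>2 + 2 * B x y + (nrm y)\<^sup>2"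
    by (simp add: nrm_sq B_add B_sym[of y x])
  also have "\<dots> \<le> (nrm x + nrm y)\<^sup>2"
    using B_cs[of x y] by (simp add: power2_sum)
  finally show "(nrm (x + y))\<^sup>2 \<le> (nrm x + nrm y)\<^sup>2" .
qed simp

lemma nrm_triangle_diff: "nrm (x - y) \<le> nrm x + nrm y"
  using nrm_triangle[of x "- y"] by simp

lemma nrm_fst: "norm (fst y) \<le> 2 / \<alpha> * nrm y"
proof -
  have "\<alpha>\<^sup>2 / 4 * (norm (fst y))\<^sup>2 \<le> B y y"
    by (rule order_trans[OF _ B_lower[of "fst y" "snd y", unfolded prod.collapse]]) simp
  then have "(\<alpha> / 2 * norm (fst y))\<^sup>2 \<le> (nrm y)\<^sup>2"
    by (simp add: nrm_sq power_mult_distrib power_divide)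
  then have "\<alpha> / 2 * norm (fst y) \<le> nrm y" by (rule power2_le_imp_le) simp
  then show ?thesis using alpha by (simp add: field_simps)
qed

lemma norm_le_nrm: "norm y \<le> (2 / \<alpha> + 2) * nrm y"
proof -
  let ?w = "(\<alpha> / 2) *\<^sub>R fst y + snd y"
  have "(norm ?w)\<^sup>2 \<le> (nrm y)\<^sup>2"
  proof -
    have "0 \<le> \<alpha>\<^sup>2 / 4 * (norm (fst y))\<^sup>2" by simp
    then show ?thesis using B_lower[of "fst y" "snd y"] by (simp only: nrm_sq prod.collapse)
  qed
  then have w: "norm ?w \<le> nrm y" by (rule power2_le_imp_le) simp
  have "norm (snd y) = norm (?w - (\<alpha> / 2) *\<^sub>R fst y)" by simp
  also have "\<dots> \<le> norm ?w + norm ((\<alpha> / 2) *\<^sub>R fst y)" by (rule norm_triangle_ineq4)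
  also have "\<dots> = norm ?w + \<alpha> / 2 * norm (fst y)" using alpha by simp
  also have "\<dots> \<le> 2 * nrm y" using w nrm_fst[of y] alpha by (simp add: field_simps)
  finally have "norm (snd y) \<le> 2 * nrm y" .
  then show ?thesis using norm_Pair_le[of "fst y" "snd y"] nrm_fst[of y]
    by (simp add: algebra_simps)
qed

lemma nrm_eq_0: "nrm y = 0 \<Longrightarrow> y = 0"
  using norm_le_nrm[of y] by simp

lemma continuous_on_nrm [continuous_intros]:
  assumes "continuous_on S h"
  shows "continuous_on S (\<lambda>x. nrm (h x))"
  unfolding norm_E_def
  by (intro continuous_intros bounded_bilinear.continuous_on[OF bounded_bilinear_B] assms)

lemma continuous_on_Q [continuous_intros]:
  "continuous_on S h \<Longrightarrow> continuous_on S (\<lambda>x. Q (h x))"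
  by (rule bounded_linear.continuous_on[OF linear_conv_bounded_linear[THEN iffD1, OF linear_Q]])

text \<open>In particular \<open>E1\<close> and \<open>E2\<close> are orthogonal for the adapted form.\<close>

lemma B_P: "B (P x) y = \<alpha>\<^sup>2 / 2 * real CARD('j) * coord x * coord y"
proof -
  have *: "(\<alpha> / 2) *\<^sub>R vec c + 0 = (vec (\<alpha> / 2 * c) :: real^'j)" for c
    by (simp add: scaleR_vec)
  show ?thesis using alpha
    by (cases y) (simp add: P_eq B_eq * inner_vec_const phase_coord_def power2_eq_square field_simps
      del: add_0_right)
qed

lemma B_P_Q: "B (P x) (Q y) = 0" "B (Q y) (P x) = 0"
  by (simp_all add: B_P B_sym[of "Q y"])

lemma nrm_split: "(nrm y)\<^sup>2 = (nrm (P y))\<^sup>2 + (nrm (Q y))\<^sup>2"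
proof -
  have "B y y = B (P y + Q y) (P y + Q y)" by (simp add: PQ)
  then show ?thesis by (simp only: nrm_sq B_add B_P_Q)
qed

text \<open>
  Reflection in \<open>E2\<close> is an isometry. This gives the constant \<open>1\<close> in the derivative of the difference
  of the squared norms of the two parts.
\<close>

lemma nrm_Q_minus_P: "nrm (Q y - P y) = nrm y"
proof -
  have "(nrm (Q y - P y))\<^sup>2 = (nrm y)\<^sup>2"
    unfolding nrm_split[of y] by (simp only: nrm_sq B_diff B_P_Q)
  then show ?thesis by (simp add: power2_eq_iff_nonneg)
qed

lemma coord_Lin [simp]: "coord (Lin y) = 0"
  using alpha by (cases y) (simp add: Lin_def phase_coord_def)

lemma Lin_diff: "Lin (x - y) = Lin x - Lin y"
  by (cases x; cases y) (simp add: Lin_def matrix_vector_mult_diff_distrib algebra_simps)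

lemma linear_Lin: "linear Lin"
  by (rule linearI) (auto simp: Lin_def matrix_vector_right_distrib matrix_vector_mult_scaleR
      algebra_simps split: prod.splits)

lemma Lin_vec [simp]: "Lin (vec c, 0) = 0" by (simp add: Lin_def zero_prod_def)

lemma rate_le: "rate \<le> \<alpha> / 2" by (simp add: rate_def)

text \<open>
  The linear part contracts \<open>E2\<close> with the given rate. The mean values and the fluctuations of
  the two components decouple. The mean values are damped with rate \<open>\<alpha>\<close>.
\<close>

lemma Lin_dissipative_E2:
  assumes "coord y = 0"
  shows "B y (Lin y) \<le> - rate * B y y"
proof -
  obtain u v where y: "y = (u, v)" by (cases y)
  define n \<Lambda> m where "n = real CARD('j)" and "\<Lambda> = \<delta> * K * lam1" and "m = avg u"
  have av: "avg v = - \<alpha> * m"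
    using assms alpha by (simp add: y phase_coord_def m_def field_simps)
  define U V X S where "U = fluct u \<bullet> fluct u" and "V = fluct v \<bullet> fluct v"
    and "X = fluct u \<bullet> fluct v" and "S = K * ((A *v u) \<bullet> u)"
  define w where "w = (\<alpha> / 2) *\<^sub>R fluct u + fluct v"
  define M where "M = \<alpha>\<^sup>2 / 4 * U + w \<bullet> w + S - \<Lambda> * U"
  have uu: "u \<bullet> u = U + n * m\<^sup>2" and vv: "v \<bullet> v = V + n * (\<alpha> * m)\<^sup>2"
    and uv: "u \<bullet> v = X - n * \<alpha> * m\<^sup>2"
    by (simp_all add: inner_fluct[of u u] inner_fluct[of v v] inner_fluct[of u v] U_def V_def X_def
        n_def m_def[symmetric] av power2_eq_square)
  have ww: "w \<bullet> w = \<alpha>\<^sup>2 / 4 * U + \<alpha> * X + V"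
    by (simp add: w_def U_def V_def X_def inner_add_left inner_add_right inner_commute[of "fluct
        v" "fluct u"]
        power2_eq_square algebra_simps)
  have Byy: "B y y = M + n * (\<alpha> * m)\<^sup>2 / 2"
    unfolding y B_eq M_def ww S_def[symmetric] U_def[symmetric] \<Lambda>_def[symmetric]
    by (simp add: uu vv uv inner_add_left inner_add_right inner_commute[of v u] power2_eq_square
        field_simps)
  have BL: "B y (Lin y) = - \<alpha> / 2 * (V + n * (\<alpha> * m)\<^sup>2) - \<alpha> / 2 * S - \<Lambda> * X"
  proof -
    have expand: "\<alpha>\<^sup>2 / 4 * (u \<bullet> v) + ((\<alpha> / 2) *\<^sub>R u + v) \<bullet> ((\<alpha> / 2) *\<^sub>R v + (- (K *\<^sub>R x) - \<alpha> *\<^sub>R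
        v)) + K * (x \<bullet> v)
      = - \<alpha> / 2 * (v \<bullet> v) - \<alpha> / 2 * (K * (x \<bullet> u))" for x
      by (simp add: inner_add_left inner_add_right inner_diff_right inner_commute[of v u]
        inner_commute[of u x] inner_commute[of v x] power2_eq_square algebra_simps)
    show ?thesis
      unfolding y Lin_def prod.case B_eq expand vv[symmetric] S_def X_def \<Lambda>_def ..
  qed
  define \<theta> where "\<theta> = \<alpha> / 2 - \<Lambda> / \<alpha>"
  define Z where "Z = fluct u \<bullet> w"
  have Z: "Z = \<alpha> / 2 * U + X"
    by (simp add: Z_def w_def U_def X_def inner_add_right)
  have id: "\<alpha> / 2 * V + \<alpha> / 2 * S + \<Lambda> * X = \<alpha> / 2 * M - \<theta> * (\<alpha> * Z)"
    using alpha by (simp add: M_def ww Z \<theta>_def power2_eq_square field_simps)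
  have "\<Lambda> * U \<le> S" unfolding \<Lambda>_def U_def S_def by (rule gap_fluct')
  moreover have "\<alpha> * \<bar>Z\<bar> \<le> \<alpha>\<^sup>2 / 4 * U + w \<bullet> w"
  proof -
    have "\<bar>Z\<bar> \<le> norm (fluct u) * norm w" unfolding Z_def by (rule Cauchy_Schwarz_ineq2)
    then have "\<alpha> * \<bar>Z\<bar> \<le> \<alpha> * (norm (fluct u) * norm w)" using alpha by simp
    also have "\<dots> \<le> (\<alpha> / 2 * norm (fluct u))\<^sup>2 + (norm w)\<^sup>2"
      using zero_le_power2[of "\<alpha> / 2 * norm (fluct u) - norm w"]
      by (simp add: power2_eq_square algebra_simps)
    finally show ?thesis
      by (simp add: U_def power2_norm_eq_inner power_mult_distrib power_divide)
  qed
  ultimately have ZM: "\<alpha> * \<bar>Z\<bar> \<le> M" by (simp add: M_def)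
  have "\<theta> * (\<alpha> * Z) \<le> \<bar>\<theta>\<bar> * (\<alpha> * \<bar>Z\<bar>)"
    using alpha by (metis abs_ge_self abs_mult abs_of_pos)
  also have "\<dots> \<le> \<bar>\<theta>\<bar> * M" by (rule mult_left_mono[OF ZM]) simp
  finally have 1: "\<theta> * (\<alpha> * Z) \<le> \<bar>\<theta>\<bar> * M" .
  have "rate * (n * (\<alpha> * m)\<^sup>2 / 2) \<le> \<alpha> / 2 * (n * (\<alpha> * m)\<^sup>2)"
  proof -
    have "rate * (n * (\<alpha> * m)\<^sup>2 / 2) \<le> \<alpha> * (n * (\<alpha> * m)\<^sup>2 / 2)"
      using rate_le alpha by (intro mult_right_mono) (auto simp: n_def)
    then show ?thesis by simp
  qed
  moreover have "rate = \<alpha> / 2 - \<bar>\<theta>\<bar>" by (simp add: rate_def \<theta>_def \<Lambda>_def)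
  then have "rate * M = \<alpha> / 2 * M - \<bar>\<theta>\<bar> * M" by (simp add: left_diff_distrib)
  ultimately show ?thesis using 1 id unfolding Byy BL by (simp add: algebra_simps)
qed

lemma Lin_dissipative:
  "B y (Lin y) \<le> - rate * (nrm (Q y))\<^sup>2" "B (Q y) (Lin y) \<le> - rate * (nrm (Q y))\<^sup>2"
proof -
  have "Lin (Q y) = Lin y" by (simp add: Q_eq Lin_diff)
  then show *: "B (Q y) (Lin y) \<le> - rate * (nrm (Q y))\<^sup>2"
    using Lin_dissipative_E2[of "Q y"] by (simp add: nrm_sq)
  have "B y (Lin y) = B (P y + Q y) (Lin y)" by (simp add: PQ)
  also have "\<dots> = B (Q y) (Lin y)" by (simp only: B_add B_P) simp
  finally show "B y (Lin y) \<le> - rate * (nrm (Q y))\<^sup>2" using * by simp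
qed

end


section \<open>Estimates for solutions with a given forcing\<close>

text \<open>Gronwall's inequality in differential form. At time \<open>0\<close> the derivative may be one-sided.\<close>

lemma exp_decay:
  fixes h h' :: "real \<Rightarrow> real"
  assumes der: "\<And>t. s \<le> t \<Longrightarrow> t \<le> T \<Longrightarrow> (h has_real_derivative h' t) (at t within {0..})"
    and le: "\<And>t. s \<le> t \<Longrightarrow> t \<le> T \<Longrightarrow> h' t \<le> - c * h t"
    and "0 \<le> s" "s \<le> T"
  shows "h T \<le> exp (- c * (T - s)) * h s"
proof (cases "s = T")
  case False
  then have "s < T" using assms by simp
  define k where "k t = exp (c * t) * h t" for t
  have k: "(k has_real_derivative exp (c * t) * (c * h t + h' t)) (at t within {0..})"
    if "s \<le> t" "t \<le> T" for t
  proof -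
    have "((\<lambda>t. exp (c * t)) has_real_derivative c * exp (c * t)) (at t within {0..})"
      by (auto intro!: derivative_eq_intros)
    from DERIV_mult[OF this der[OF that]] show ?thesis
      unfolding k_def by (simp add: algebra_simps)
  qed
  have "k T \<le> k s"
  proof (rule DERIV_nonpos_imp_decreasing_open[OF less_imp_le[OF \<open>s < T\<close>]])
    fix t assume t: "s < t" "t < T"
    then have "t \<in> interior {0..}" using \<open>0 \<le> s\<close> by (simp add: interior_real_atLeast)
    with k[of t] t have "DERIV k t :> exp (c * t) * (c * h t + h' t)"
      by (metis at_within_interior less_imp_le)
    moreover have "exp (c * t) * (c * h t + h' t) \<le> 0"
      using le[of t] t by (intro mult_nonneg_nonpos) auto
    ultimately show "\<exists>y. DERIV k t :> y \<and> y \<le> 0" by blast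
  next
    show "continuous_on {s..T} k"
      unfolding continuous_on_eq_continuous_within
      by (meson DERIV_continuous atLeastAtMost_iff assms(3) atLeast_iff continuous_within_subset k
          order_trans subsetI)
  qed
  then have "exp (- c * T) * k T \<le> exp (- c * T) * k s" by (rule mult_left_mono) simp
  moreover have "exp (- c * T) * k t = exp (- c * (T - t)) * h t" for t
  proof -
    have "exp (- c * T) * exp (c * t) = exp (- c * (T - t))"
      by (subst exp_add[symmetric]) (simp add: algebra_simps)
    then show ?thesis by (simp add: k_def mult.assoc[symmetric])
  qed
  ultimately have "exp (- c * (T - T)) * h T \<le> exp (- c * (T - s)) * h s" by (simp only:)
  then show ?thesis by simp
qed simp

lemma lipschitz_of_deriv_bound:
  fixes g :: "real \<Rightarrow> real"
  assumes "g C1_differentiable_on UNIV" "\<And>x. \<bar>deriv g x\<bar> \<le> c"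
  shows "\<bar>g x - g y\<bar> \<le> c * \<bar>x - y\<bar>"
proof -
  obtain D where D: "\<And>x. (g has_vector_derivative D x) (at x)"
    using assms(1) by (auto simp: C1_differentiable_on_def)
  then have "(g has_real_derivative D x) (at x)" for x
    by (simp add: has_real_derivative_iff_has_vector_derivative)
  then have "(g has_real_derivative deriv g x) (at x)" for x
    by (metis DERIV_imp_deriv)
  then have "norm (g x - g y) \<le> c * norm (x - y)"
    by (intro field_differentiable_bound[of UNIV g "deriv g" c]) (use assms(2) in \<open>auto intro:
        has_field_derivative_at_within\<close>)
  then show ?thesis by simp
qed

lemma norm_vec_le:
  fixes u w :: "real^'j::finite"
  assumes "\<And>i. \<bar>u $ i\<bar> \<le> b * \<bar>w $ i\<bar>" "0 \<le> b"
  shows "norm u \<le> b * norm w"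
proof -
  have "norm u \<le> norm (b *\<^sub>R w)"
    unfolding norm_vec_def using assms by (intro L2_set_mono) (auto simp: abs_mult)
  then show ?thesis using assms by simp
qed

text \<open>
  The nonlinear system. The parameter \<open>L\<close> is the Lipschitz constant of the nonlinearity in the
  adapted norm.
\<close>

locale damped_system = adapted_form A \<alpha> K \<delta> lam1
  for A :: "real^'j^'j::finite" and \<alpha> K \<delta> lam1 :: real +
  fixes \<beta> :: real and f :: "real^'j" and g :: "real \<Rightarrow> real" and \<kappa> c1 c2 M1 L :: real
  assumes g_lip: "\<And>x y. \<bar>g x - g y\<bar> \<le> c2 * \<bar>x - y\<bar>" and c2_nonneg: "0 \<le> c2"
    and g_bound: "\<And>x. \<bar>g x\<bar> \<le> c1"
    and period: "0 < \<kappa>" "\<And>x. g (x + \<kappa>) = g x"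
    and M1: "0 < M1" "\<And>y. nrm y \<le> M1 * norm y"
    and L_eq: "L = 2 * c2 * \<bar>\<beta>\<bar> / \<alpha>" and rate_gt: "rate > 4 * L"
begin

abbreviation field :: "real^'j \<Rightarrow> 'j phase \<Rightarrow> 'j phase" where
  "field \<equiv> vector_field A \<alpha> K \<beta> f g"

lemma L_nonneg: "0 \<le> L" using c2_nonneg alpha by (simp add: L_eq)
lemma rate_pos: "0 < rate" using L_nonneg rate_gt by simp

text \<open>The remainder of the vector field, a function of the forcing and of the state.\<close>

definition Nonlin :: "real^'j \<Rightarrow> 'j phase \<Rightarrow> 'j phase" where
  "Nonlin z y = (z, f - \<beta> *\<^sub>R (\<chi> j. g (fst y $ j)) + (1 - \<alpha>) *\<^sub>R z)"

lemma field_eq: "field z y = Lin y + Nonlin z y"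
  by (cases y) (simp add: vector_field_def Lin_def Nonlin_def)

lemma norm_g_diff: "norm ((\<chi> j. g (fst x $ j)) - (\<chi> j. g (fst y $ j)) :: real^'j) \<le> c2 * norm (fst
    x - fst y)"
  by (rule norm_vec_le) (use g_lip c2_nonneg in auto)

lemma nrm_snd: "nrm (0, w) = norm w"
  by (simp add: norm_E_def B_eq norm_eq_sqrt_inner)

lemma Nonlin_lipschitz: "nrm (Nonlin z x - Nonlin z y) \<le> L * nrm (x - y)"
proof -
  have "Nonlin z x - Nonlin z y = (0, - \<beta> *\<^sub>R ((\<chi> j. g (fst x $ j)) - (\<chi> j. g (fst y $ j))))"
    by (simp add: Nonlin_def algebra_simps)
  then have "nrm (Nonlin z x - Nonlin z y) = \<bar>\<beta>\<bar> * norm ((\<chi> j. g (fst x $ j)) - (\<chi> j. g (fst y $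
      j)) :: real^'j)"
    by (simp add: nrm_snd)
  also have "\<dots> \<le> \<bar>\<beta>\<bar> * (c2 * norm (fst (x - y)))"
    using norm_g_diff[of x y] by (intro mult_left_mono) auto
  also have "\<dots> \<le> \<bar>\<beta>\<bar> * (c2 * (2 / \<alpha> * nrm (x - y)))"
    using nrm_fst[of "x - y"] c2_nonneg by (intro mult_left_mono) auto
  finally show ?thesis by (simp add: L_eq mult_ac)
qed

text \<open>
  The constants in the absorbing radius. They bound the remainder affinely in the norm of the
  forcing.
\<close>

definition a1 :: real where "a1 = M1 * sqrt (3 * \<alpha>\<^sup>2 - 6 * \<alpha> + 4)"
definition a2 :: real where "a2 = M1 * sqrt (3 * (norm f)\<^sup>2 + 3 * \<beta>\<^sup>2 * c1\<^sup>2 * real CARD('j))"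

lemma a1_radicand: "0 \<le> 3 * \<alpha>\<^sup>2 - 6 * \<alpha> + 4"
  using zero_le_power2[of "1 - \<alpha>"] by (simp add: power2_eq_square algebra_simps)

lemma a1_nonneg: "0 \<le> a1" and a2_nonneg: "0 \<le> a2"
  using M1 a1_radicand by (auto simp: a1_def a2_def)

lemma nrm_Nonlin: "nrm (Nonlin z y) \<le> a1 * norm z + a2"
proof -
  let ?G = "(\<chi> j. g (fst y $ j)) :: real^'j"
  have c1: "0 \<le> c1" using g_bound[of 0] by simp
  have "norm ?G \<le> c1 * norm (1 :: real^'j)"
    by (rule norm_vec_le) (use g_bound c1 in auto)
  then have "(norm ?G)\<^sup>2 \<le> (c1 * norm (1 :: real^'j))\<^sup>2" by (rule power_mono) simp
  also have "(norm (1 :: real^'j))\<^sup>2 = real CARD('j)"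
    using inner_vec_const(1)[of "1 :: real^'j" 1] by (simp add: power2_norm_eq_inner)
  then have "(c1 * norm (1 :: real^'j))\<^sup>2 = c1\<^sup>2 * real CARD('j)" by (simp add: power_mult_distrib)
  finally have G: "(norm ?G)\<^sup>2 \<le> c1\<^sup>2 * real CARD('j)" .
  have three: "(norm (x + y + w))\<^sup>2 \<le> 3 * ((norm x)\<^sup>2 + (norm y)\<^sup>2 + (norm w)\<^sup>2)" for x y w ::
      "real^'j"
  proof -
    have "(norm (x + y + w))\<^sup>2 \<le> (norm x + norm y + norm w)\<^sup>2"
      by (intro power_mono order_trans[OF norm_triangle_ineq] add_right_mono norm_triangle_ineq)
          auto
    also have "\<dots> \<le> 3 * ((norm x)\<^sup>2 + (norm y)\<^sup>2 + (norm w)\<^sup>2)"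
      using zero_le_power2[of "norm x - norm y"] zero_le_power2[of "norm x - norm w"]
        zero_le_power2[of "norm y - norm w"] by (simp add: power2_eq_square algebra_simps)
    finally show ?thesis .
  qed
  have "(norm (Nonlin z y))\<^sup>2 = (norm z)\<^sup>2 + (norm (f + (- \<beta>) *\<^sub>R ?G + (1 - \<alpha>) *\<^sub>R z))\<^sup>2"
    by (simp add: Nonlin_def norm_Pair)
  also have "\<dots> \<le> (norm z)\<^sup>2 + 3 * ((norm f)\<^sup>2 + (norm ((- \<beta>) *\<^sub>R ?G))\<^sup>2 + (norm ((1 - \<alpha>) *\<^sub>R z))\<^sup>2)"
    by (intro add_left_mono three)
  also have "\<dots> = (norm z)\<^sup>2 + 3 * ((norm f)\<^sup>2 + \<beta>\<^sup>2 * (norm ?G)\<^sup>2 + (1 - \<alpha>)\<^sup>2 * (norm z)\<^sup>2)"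
    by (simp add: power_mult_distrib)
  also have "\<dots> \<le> (norm z)\<^sup>2 + 3 * ((norm f)\<^sup>2 + \<beta>\<^sup>2 * (c1\<^sup>2 * real CARD('j)) + (1 - \<alpha>)\<^sup>2 * (norm
      z)\<^sup>2)"
    using G by (intro add_mono mult_left_mono) auto
  also have "\<dots> = (3 * \<alpha>\<^sup>2 - 6 * \<alpha> + 4) * (norm z)\<^sup>2 + (3 * (norm f)\<^sup>2 + 3 * \<beta>\<^sup>2 * c1\<^sup>2 * real
      CARD('j))"
    (is "_ = ?r * _ + ?s")
    by (simp add: power2_eq_square algebra_simps)
  finally have "sqrt ((norm (Nonlin z y))\<^sup>2) \<le> sqrt (?r * (norm z)\<^sup>2 + ?s)"
    by (rule real_sqrt_le_mono)
  also have "\<dots> \<le> sqrt (?r * (norm z)\<^sup>2) + sqrt ?s"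
    using a1_radicand by (intro sqrt_add_le_add_sqrt) auto
  also have "\<dots> = sqrt ?r * norm z + sqrt ?s" by (simp add: real_sqrt_mult)
  finally have "M1 * norm (Nonlin z y) \<le> M1 * (sqrt ?r * norm z + sqrt ?s)"
    using M1 by simp
  then show ?thesis using M1(2)[of "Nonlin z y"] by (simp add: a1_def a2_def algebra_simps)
qed

lemma g_period_int: "g (x + of_int k * \<kappa>) = g x"
proof (induction k arbitrary: x rule: int_induct[of _ 0])
  case (step1 k)
  then show ?case using period(2)[of "x + of_int k * \<kappa>"] by (simp add: algebra_simps)
next
  case (step2 k)
  then show ?case using period(2)[of "x + of_int k * \<kappa> - \<kappa>"] by (simp add: algebra_simps)
qed simp

lemma field_translate: "field z (y + of_int k *\<^sub>R (\<kappa> *\<^sub>R eta0)) = field z y"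
proof -
  have e: "of_int k *\<^sub>R (\<kappa> *\<^sub>R eta0) = (vec (of_int k * \<kappa>), 0 :: real^'j)"
    by (simp add: eta0_def vec_eq_iff)
  have "Lin (y + (vec (of_int k * \<kappa>), 0)) = Lin y"
    using linear_add[OF linear_Lin, of y "(vec (of_int k * \<kappa>), 0)"] by simp
  then show ?thesis
    unfolding field_eq e by (simp add: Nonlin_def g_period_int)
qed

text \<open>
  Solutions on the half-line of the system with forcing \<open>\<zeta>\<close>, a function of time in place of
  \<open>ou eps (shift t \<omega>)\<close>.
\<close>

definition solves :: "(real \<Rightarrow> real^'j) \<Rightarrow> (real \<Rightarrow> 'j phase) \<Rightarrow> bool" where
  "solves \<zeta> X \<longleftrightarrow> (\<forall>t\<ge>0. (X has_vector_derivative field (\<zeta> t) (X t)) (at t within {0..}))"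

lemma solves_translate:
  assumes "solves \<zeta> X"
  shows "solves \<zeta> (\<lambda>t. X t + of_int k *\<^sub>R (\<kappa> *\<^sub>R eta0))"
  using assms unfolding solves_def field_translate has_vector_derivative_add_const .

lemma solves_shift:
  assumes "solves \<zeta> X" "0 \<le> s"
  shows "solves (\<lambda>t. \<zeta> (t + s)) (\<lambda>t. X (t + s))"
  unfolding solves_def
proof (intro allI impI)
  fix t :: real assume "0 \<le> t"
  then have "(X has_vector_derivative field (\<zeta> (t + s)) (X (t + s))) (at (t + s) within {0..})"
    using assms by (simp add: solves_def)
  then have "(X has_vector_derivative field (\<zeta> (t + s)) (X (t + s))) (at (t + s) within (\<lambda>t. t +
      s) ` {0..})"
    by (rule has_vector_derivative_within_subset) (use assms in auto)
  moreover have "((\<lambda>t. t + s) has_vector_derivative 1) (at t within {0..})"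
    by (auto intro!: derivative_eq_intros)
  ultimately have "(X \<circ> (\<lambda>t. t + s) has_vector_derivative 1 *\<^sub>R field (\<zeta> (t + s)) (X (t + s))) (at
      t within {0..})"
    by (intro vector_diff_chain_within)
  then show "((\<lambda>t. X (t + s)) has_vector_derivative field (\<zeta> (t + s)) (X (t + s))) (at t within
      {0..})"
    by (simp add: o_def)
qed

lemma nrm_derivative:
  assumes "(X has_vector_derivative X') (at t within S)"
  shows "((\<lambda>t. (nrm (X t))\<^sup>2) has_real_derivative 2 * B (X t) X') (at t within S)"
    and "((\<lambda>t. (nrm (Q (X t)))\<^sup>2) has_real_derivative 2 * B (Q (X t)) X') (at t within S)"
    and "((\<lambda>t. (nrm (P (X t)))\<^sup>2) has_real_derivative 2 * B (P (X t)) X') (at t within S)"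
proof -
  have *: "((\<lambda>t. (nrm (X t))\<^sup>2) has_real_derivative 2 * B (X t) X') (at t within S)"
    if "(X has_vector_derivative X') (at t within S)" for X X'
    using bounded_bilinear.has_vector_derivative[OF bounded_bilinear_B that that]
    by (simp add: nrm_sq has_real_derivative_iff_has_vector_derivative B_sym[of X' "X t"])
  show 1: "((\<lambda>t. (nrm (X t))\<^sup>2) has_real_derivative 2 * B (X t) X') (at t within S)"
    by (rule *[OF assms])
  have "((\<lambda>t. Q (X t)) has_vector_derivative Q X') (at t within S)"
    by (rule bounded_linear.has_vector_derivative[OF linear_conv_bounded_linear[THEN iffD1, OF
        linear_Q] assms])
  then have "((\<lambda>t. (nrm (Q (X t)))\<^sup>2) has_real_derivative 2 * B (Q (X t)) (Q X')) (at t within S)"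
    by (rule *)
  moreover have "B (Q y) (Q z) = B (Q y) z" for y z
  proof -
    have "B (Q y) z = B (Q y) (P z + Q z)" by (simp add: PQ)
    then show ?thesis by (simp only: B_add B_P_Q)
  qed
  ultimately show 2: "((\<lambda>t. (nrm (Q (X t)))\<^sup>2) has_real_derivative 2 * B (Q (X t)) X') (at t
      within S)"
    by simp
  have "B (X t) X' - B (Q (X t)) X' = B (P (X t)) X'"
    by (simp add: Q_E2_def B_diff)
  moreover have "((\<lambda>t. (nrm (X t))\<^sup>2 - (nrm (Q (X t)))\<^sup>2) has_real_derivative 2 * B (X t) X' - 2 *
      B (Q (X t)) X') (at t within S)"
    by (rule DERIV_diff[OF 1 2])
  ultimately show "((\<lambda>t. (nrm (P (X t)))\<^sup>2) has_real_derivative 2 * B (P (X t)) X') (at t within S)"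
  proof -
    assume *: "B (X t) X' - B (Q (X t)) X' = B (P (X t)) X'"
      and der: "((\<lambda>t. (nrm (X t))\<^sup>2 - (nrm (Q (X t)))\<^sup>2) has_real_derivative 2 * B (X t) X' - 2 *
          B (Q (X t)) X') (at t within S)"
    have "(nrm y)\<^sup>2 - (nrm (Q y))\<^sup>2 = (nrm (P y))\<^sup>2" for y using nrm_split[of y] by linarith
    moreover have "2 * B (X t) X' - 2 * B (Q (X t)) X' = 2 * B (P (X t)) X'" using * by linarith
    ultimately show ?thesis using der by (simp only:)
  qed
qed

lemma difference_derivative:
  assumes "solves \<zeta> X" "solves \<zeta> Y"
  obtains \<Delta> where
    "\<And>t. 0 \<le> t \<Longrightarrow> ((\<lambda>t. X t - Y t) has_vector_derivative Lin (X t - Y t) + \<Delta> t) (at t within {0..})"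
    "\<And>t. nrm (\<Delta> t) \<le> L * nrm (X t - Y t)"
proof
  fix t :: real
  show "nrm (Nonlin (\<zeta> t) (X t) - Nonlin (\<zeta> t) (Y t)) \<le> L * nrm (X t - Y t)"
    by (rule Nonlin_lipschitz)
  assume "0 \<le> t"
  then show "((\<lambda>t. X t - Y t) has_vector_derivative
      Lin (X t - Y t) + (Nonlin (\<zeta> t) (X t) - Nonlin (\<zeta> t) (Y t))) (at t within {0..})"
    using has_vector_derivative_diff[of X "field (\<zeta> t) (X t)" _ Y "field (\<zeta> t) (Y t)"] assms
    by (simp add: solves_def field_eq Lin_diff algebra_simps)
qed

lemma solves_lipschitz:
  assumes X: "solves \<zeta> X" and Y: "solves \<zeta> Y" and "0 \<le> T"
  shows "nrm (X T - Y T) \<le> exp (L * T) * nrm (X 0 - Y 0)"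
proof -
  obtain \<Delta> where der: "\<And>t. 0 \<le> t \<Longrightarrow> ((\<lambda>t. X t - Y t) has_vector_derivative Lin (X t - Y t) + \<Delta> t)
      (at t within {0..})"
    and \<Delta>: "\<And>t. nrm (\<Delta> t) \<le> L * nrm (X t - Y t)"
    using difference_derivative[OF X Y] by blast
  have "(nrm (X T - Y T))\<^sup>2 \<le> exp (- (- 2 * L) * (T - 0)) * (nrm (X 0 - Y 0))\<^sup>2"
  proof (rule exp_decay)
    fix t :: real assume t: "0 \<le> t"
    let ?D = "X t - Y t"
    show "((\<lambda>t. (nrm (X t - Y t))\<^sup>2) has_real_derivative 2 * B ?D (Lin ?D + \<Delta> t)) (at t within
        {0..})"
      by (rule nrm_derivative(1)[OF der[OF t]])
    have "B ?D (Lin ?D) \<le> 0"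
      using Lin_dissipative(1)[of ?D] rate_pos by (smt (verit) mult_nonneg_nonneg zero_le_power2
          mult_minus_left)
    moreover have "B ?D (\<Delta> t) \<le> nrm ?D * (L * nrm ?D)"
      using B_cs[of ?D "\<Delta> t"] \<Delta>[of t] by (smt (verit) mult_left_mono nrm_nonneg)
    ultimately show "2 * B ?D (Lin ?D + \<Delta> t) \<le> - (- 2 * L) * (nrm ?D)\<^sup>2"
      by (simp add: B_add power2_eq_square algebra_simps)
  qed (use \<open>0 \<le> T\<close> in auto)
  also have "\<dots> = (exp (L * T) * nrm (X 0 - Y 0))\<^sup>2"
    by (simp add: power_mult_distrib exp_double[symmetric] mult.assoc)
  finally show ?thesis by (rule power2_le_imp_le) simp
qed

lemma solves_unique:
  assumes "solves \<zeta> X" "solves \<zeta> Y" "X 0 = Y 0" "0 \<le> T"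
  shows "X T = Y T"
proof -
  have "nrm (X T - Y T) = 0"
    using solves_lipschitz[OF assms(1,2,4)] assms(3) by (simp add: antisym)
  then show ?thesis using nrm_eq_0 by fastforce
qed

text \<open>
  Cone invariance and squeezing. The difference of two solutions cannot leave the cone in which
  the \<open>E1\<close>-part dominates. As long as it stays outside of that cone, its \<open>E2\<close>-part decays.
\<close>

lemma cone_squeezing:
  assumes X: "solves \<zeta> X" and Y: "solves \<zeta> Y" and T: "0 \<le> T"
  shows "nrm (Q (X T - Y T)) \<le> nrm (P (X T - Y T)) + exp (- (rate - 2 * L) * T) * nrm (Q (X 0 - Y
      0))"
proof -
  obtain \<Delta> where der: "\<And>t. 0 \<le> t \<Longrightarrow> ((\<lambda>t. X t - Y t) has_vector_derivative Lin (X t - Y t) + \<Delta> t)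
      (at t within {0..})"
    and \<Delta>: "\<And>t. nrm (\<Delta> t) \<le> L * nrm (X t - Y t)"
    using difference_derivative[OF X Y] by blast
  define D where "D t = X t - Y t" for t
  note der = der[folded D_def] and \<Delta> = \<Delta>[folded D_def]
  show ?thesis unfolding D_def[symmetric]
  proof (cases "\<exists>s\<in>{0..T}. nrm (Q (D s)) \<le> nrm (P (D s))")
    case True
    \<comment> \<open>Once in the cone at time \<open>s\<close>, the difference stays there.\<close>
    then obtain s where s: "0 \<le> s" "s \<le> T" "nrm (Q (D s)) \<le> nrm (P (D s))" by auto
    define h where "h t = (nrm (Q (D t)))\<^sup>2 - (nrm (P (D t)))\<^sup>2" for t
    have "h T \<le> exp (- (2 * (rate - L)) * (T - s)) * h s"
    proof (rule exp_decay)
      fix t assume "s \<le> t" then have t: "0 \<le> t" using s by simp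
      show "(h has_real_derivative 2 * B (Q (D t)) (Lin (D t) + \<Delta> t) - 2 * B (P (D t)) (Lin (D t)
          + \<Delta> t)) (at t within {0..})"
        unfolding h_def by (intro DERIV_diff nrm_derivative der t)
      have "B (Q (D t) - P (D t)) (\<Delta> t) \<le> nrm (D t) * (L * nrm (D t))"
        using B_cs[of "Q (D t) - P (D t)" "\<Delta> t"] \<Delta>[of t]
        by (smt (verit) mult_left_mono nrm_nonneg nrm_Q_minus_P)
      also have "\<dots> = L * (nrm (D t))\<^sup>2" by (simp add: power2_eq_square)
      also have "\<dots> = L * ((nrm (P (D t)))\<^sup>2 + (nrm (Q (D t)))\<^sup>2)"
        by (simp only: nrm_split[of "D t"])
      finally have "B (Q (D t)) (\<Delta> t) - B (P (D t)) (\<Delta> t) \<le> L * ((nrm (P (D t)))\<^sup>2 + (nrm (Q (D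
          t)))\<^sup>2)"
        by (simp only: B_diff)
      moreover have "B (P (D t)) (Lin (D t)) = 0" by (simp add: B_P)
      moreover note Lin_dissipative(2)[of "D t"]
      moreover have "2 * L * (nrm (P (D t)))\<^sup>2 \<le> rate * (nrm (P (D t)))\<^sup>2"
        using rate_gt L_nonneg by (intro mult_right_mono) auto
      ultimately show "2 * B (Q (D t)) (Lin (D t) + \<Delta> t) - 2 * B (P (D t)) (Lin (D t) + \<Delta> t)
          \<le> - (2 * (rate - L)) * h t"
        unfolding h_def B_add by (simp add: algebra_simps)
    qed (use s in auto)
    also have "\<dots> \<le> 0"
    proof -
      have "h s \<le> 0" using power_mono[OF s(3) nrm_nonneg, of 2] by (simp add: h_def)
      then show ?thesis by (intro mult_nonneg_nonpos) auto
    qed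
    finally have "(nrm (Q (D T)))\<^sup>2 \<le> (nrm (P (D T)))\<^sup>2" by (simp add: h_def)
    then have "nrm (Q (D T)) \<le> nrm (P (D T))" by (rule power2_le_imp_le) simp
    then show "nrm (Q (D T)) \<le> nrm (P (D T)) + exp (- (rate - 2 * L) * T) * nrm (Q (D 0))"
      by (smt (verit) exp_ge_zero mult_nonneg_nonneg nrm_nonneg)
  next
    case False
    \<comment> \<open>Here \<open>nrm (D t) \<le> 2 * nrm (Q (D t))\<close> throughout, so the \<open>E2\<close>-part satisfies a closed inequality.\<close>
    have "(nrm (Q (D T)))\<^sup>2 \<le> exp (- (2 * (rate - 2 * L)) * (T - 0)) * (nrm (Q (D 0)))\<^sup>2"
    proof (rule exp_decay)
      fix t assume t: "0 \<le> t" "t \<le> T"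
      show "((\<lambda>t. (nrm (Q (D t)))\<^sup>2) has_real_derivative 2 * B (Q (D t)) (Lin (D t) + \<Delta> t)) (at t
          within {0..})"
        by (intro nrm_derivative der t)
      have "nrm (D t) \<le> nrm (P (D t)) + nrm (Q (D t))"
        using nrm_triangle[of "P (D t)" "Q (D t)"] by (simp add: PQ)
      then have "nrm (D t) \<le> 2 * nrm (Q (D t))" using False t by force
      then have "L * nrm (D t) \<le> L * (2 * nrm (Q (D t)))" using L_nonneg by (rule mult_left_mono)
      then have "nrm (\<Delta> t) \<le> L * (2 * nrm (Q (D t)))" using \<Delta>[of t] by simp
      then have "B (Q (D t)) (\<Delta> t) \<le> nrm (Q (D t)) * (L * (2 * nrm (Q (D t))))"
        using B_cs[of "Q (D t)" "\<Delta> t"] by (smt (verit) mult_left_mono nrm_nonneg)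
      with Lin_dissipative(2)[of "D t"]
      show "2 * B (Q (D t)) (Lin (D t) + \<Delta> t) \<le> - (2 * (rate - 2 * L)) * (nrm (Q (D t)))\<^sup>2"
        unfolding B_add by (simp add: power2_eq_square algebra_simps)
    qed (use T in auto)
    also have "\<dots> = (exp (- (rate - 2 * L) * T) * nrm (Q (D 0)))\<^sup>2"
      by (simp add: power_mult_distrib exp_double[symmetric] algebra_simps)
    finally have "nrm (Q (D T)) \<le> exp (- (rate - 2 * L) * T) * nrm (Q (D 0))"
      by (rule power2_le_imp_le) simp
    then show "nrm (Q (D T)) \<le> nrm (P (D T)) + exp (- (rate - 2 * L) * T) * nrm (Q (D 0))"
      by (smt (verit) nrm_nonneg)
  qed
qed

text \<open>
  Absorption in the \<open>E2\<close>-direction, by comparison with an explicit solution of the scalar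
  equation \<open>b' = - rate * b + a1 * exp (rate / 2 * (T - s)) * \<rho> + a2\<close>. The norm is
  regularised by \<open>\<epsilon>\<close> since it is not differentiable at the origin.
\<close>

lemma absorption:
  assumes X: "solves \<zeta> X" and T: "0 \<le> T" and \<rho>: "0 \<le> \<rho>"
    and \<zeta>: "\<And>s. 0 \<le> s \<Longrightarrow> s \<le> T \<Longrightarrow> norm (\<zeta> s) \<le> exp (rate / 2 * (T - s)) * \<rho>"
  shows "nrm (Q (X T)) \<le> exp (- rate * T) * nrm (Q (X 0)) + (2 * a1 / rate * \<rho> + a2 / rate)"
proof (rule field_le_epsilon)
  fix \<epsilon> :: real assume \<epsilon>: "0 < \<epsilon>"
  define q0 where "q0 = nrm (Q (X 0))"
  define m where "m s = sqrt ((nrm (Q (X s)))\<^sup>2 + \<epsilon>\<^sup>2)" for s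
  define b where "b s = exp (- rate * s) * q0 + 2 * a1 / rate * \<rho> * exp (rate / 2 * (T - s)) + a2
      / rate" for s
  define b' where "b' s = - rate * exp (- rate * s) * q0 - a1 * \<rho> * exp (rate / 2 * (T - s))" for s
  define m' where "m' s = B (Q (X s)) (Lin (X s) + Nonlin (\<zeta> s) (X s)) / m s" for s
  have m_pos: "0 < m s" for s using \<epsilon> by (simp add: m_def add_nonneg_pos)
  have m_sq: "(m s)\<^sup>2 = (nrm (Q (X s)))\<^sup>2 + \<epsilon>\<^sup>2" for s by (simp add: m_def)
  have m_ge: "nrm (Q (X s)) \<le> m s" "\<epsilon> \<le> m s" for s
    by (rule power2_le_imp_le, simp add: m_sq, simp add: m_pos less_imp_le)+
  define k where "k s = m s - b s - \<epsilon>" for s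
  have "k T \<le> exp (- rate * (T - 0)) * k 0"
  proof (rule exp_decay)
    fix s assume s: "0 \<le> s" "s \<le> T"
    have "(X has_vector_derivative (Lin (X s) + Nonlin (\<zeta> s) (X s))) (at s within {0..})"
      using X s by (simp add: solves_def field_eq)
    from nrm_derivative(2)[OF this]
    have "((\<lambda>s. (nrm (Q (X s)))\<^sup>2 + \<epsilon>\<^sup>2) has_real_derivative 2 * B (Q (X s)) (Lin (X s) + Nonlin
        (\<zeta> s) (X s))) (at s within {0..})"
      by (rule DERIV_add[OF _ DERIV_const, simplified])
    then have "(m has_real_derivative (inverse (sqrt ((nrm (Q (X s)))\<^sup>2 + \<epsilon>\<^sup>2)) / 2) * (2 * B (Q
        (X s)) (Lin (X s) + Nonlin (\<zeta> s) (X s)))) (at s within {0..})"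
      unfolding m_def by (rule DERIV_chain'[OF _ DERIV_real_sqrt]) (use \<epsilon> in \<open>simp add:
          add_nonneg_pos\<close>)
    then have m_der: "(m has_real_derivative m' s) (at s within {0..})"
      by (simp add: m'_def m_def field_simps)
    have "(b has_real_derivative b' s) (at s within {0..})"
      unfolding b_def b'_def using rate_pos by (auto intro!: derivative_eq_intros simp: field_simps)
    then show "(k has_real_derivative (m' s - b' s)) (at s within {0..})"
      unfolding k_def using m_der by (auto intro!: derivative_eq_intros)
    define h where "h = a1 * (exp (rate / 2 * (T - s)) * \<rho>) + a2"
    have h: "0 \<le> h" using a1_nonneg a2_nonneg \<rho> by (simp add: h_def)
    have "nrm (Nonlin (\<zeta> s) (X s)) \<le> h"
      using nrm_Nonlin[of "\<zeta> s" "X s"] mult_left_mono[OF \<zeta>[OF s] a1_nonneg] by (simp add: h_def)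
    then have "B (Q (X s)) (Nonlin (\<zeta> s) (X s)) \<le> nrm (Q (X s)) * h"
      using B_cs[of "Q (X s)" "Nonlin (\<zeta> s) (X s)"] by (smt (verit) mult_left_mono nrm_nonneg)
    also have "\<dots> \<le> m s * h" using m_ge h by (intro mult_right_mono)
    finally have "m' s * m s \<le> - rate * ((m s)\<^sup>2 - \<epsilon>\<^sup>2) + m s * h"
      using Lin_dissipative(2)[of "X s"] m_pos[of s] by (simp add: m'_def B_add m_sq)
    also have "\<dots> \<le> - rate * (m s)\<^sup>2 + rate * (\<epsilon> * m s) + m s * h"
    proof -
      have "rate * (\<epsilon> * \<epsilon>) \<le> rate * (\<epsilon> * m s)"
        using \<epsilon> m_ge rate_pos by (intro mult_left_mono) auto
      then show ?thesis by (simp add: power2_eq_square algebra_simps)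
    qed
    also have "\<dots> = (- rate * m s + rate * \<epsilon> + h) * m s" by (simp add: power2_eq_square
        algebra_simps)
    finally have "m' s \<le> - rate * m s + rate * \<epsilon> + h" using m_pos[of s] by (simp only:
        mult_le_cancel_right_pos)
    moreover have "b' s = - rate * b s + h"
      using rate_pos by (simp add: b'_def b_def h_def field_simps)
    ultimately show "m' s - b' s \<le> - rate * k s" by (simp add: k_def algebra_simps)
  qed (use T in auto)
  also have "\<dots> \<le> 0"
  proof -
    have "m 0 \<le> q0 + \<epsilon>"
      unfolding m_def q0_def using sqrt_add_le_add_sqrt[of "(nrm (Q (X 0)))\<^sup>2" "\<epsilon>\<^sup>2"] \<epsilon> by simp
    moreover have "q0 \<le> b 0"
      using a1_nonneg a2_nonneg \<rho> rate_pos by (simp add: b_def)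
    ultimately have "k 0 \<le> 0" by (simp add: k_def)
    then show ?thesis by (intro mult_nonneg_nonpos) auto
  qed
  finally have "m T \<le> b T + \<epsilon>" by (simp add: k_def)
  with m_ge(1)[of T]
  show "nrm (Q (X T)) \<le> exp (- rate * T) * nrm (Q (X 0)) + (2 * a1 / rate * \<rho> + a2 / rate) + \<epsilon>"
    by (simp add: b_def q0_def)
qed

end


section \<open>Measurable dependence on the noise\<close>

context damped_system
begin

lemma continuous_g: "continuous_on UNIV g"
  by (rule lipschitz_on_continuous_on[of c2], rule lipschitz_onI)
    (use g_lip c2_nonneg in \<open>auto simp: dist_real_def\<close>)

lemma continuous_field:
  assumes z: "continuous_on S z" and y: "continuous_on S y"
  shows "continuous_on S (\<lambda>x. field (z x) (y x))"
proof -
  have "continuous_on S (\<lambda>x. Lin (y x))"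
    by (rule bounded_linear.continuous_on[OF linear_conv_bounded_linear[THEN iffD1, OF linear_Lin]
        y])
  moreover have "continuous_on S (\<lambda>x. g (fst (y x) $ j))" for j
    by (intro continuous_on_compose2[OF continuous_g] continuous_intros y) auto
  then have "continuous_on S (\<lambda>x. Nonlin (z x) (y x))"
    unfolding Nonlin_def by (intro continuous_intros z continuous_on_vec_lambda)
  ultimately show ?thesis unfolding field_eq by (rule continuous_on_add)
qed

lemma field_lipschitz:
  obtains \<Lambda> where "0 \<le> \<Lambda>" "\<And>z x y. norm (field z x - field z y) \<le> \<Lambda> * norm (x - y)"
proof -
  obtain C where C: "0 < C" "\<And>x. norm (Lin x) \<le> C * norm x"
    using linear_bounded_pos[OF linear_Lin] by blast
  define c where "c = 2 / \<alpha> + 2"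
  have c: "0 < c" using alpha by (simp add: c_def add_pos_pos)
  have "norm (field z x - field z y) \<le> (C + c * (L * M1)) * norm (x - y)" for z x y
  proof -
    have "norm (Nonlin z x - Nonlin z y) \<le> c * nrm (Nonlin z x - Nonlin z y)"
      unfolding c_def by (rule norm_le_nrm)
    also have "\<dots> \<le> c * (L * nrm (x - y))"
      using c Nonlin_lipschitz by (intro mult_left_mono) auto
    also have "\<dots> \<le> c * (L * (M1 * norm (x - y)))"
      using c L_nonneg M1(2)[of "x - y"] by (intro mult_left_mono) auto
    finally have "norm (Nonlin z x - Nonlin z y) \<le> c * (L * (M1 * norm (x - y)))" .
    moreover have diff: "field z x - field z y = Lin (x - y) + (Nonlin z x - Nonlin z y)"
      by (simp add: field_eq Lin_diff)
    moreover have "(C + c * (L * M1)) * norm (x - y) = C * norm (x - y) + c * (L * (M1 * norm (x -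
        y)))"
      by (simp add: algebra_simps)
    ultimately show ?thesis
      using norm_triangle_ineq[of "Lin (x - y)" "Nonlin z x - Nonlin z y"] C(2)[of "x - y"]
      unfolding diff by linarith
  qed
  then show ?thesis using that[of "C + c * (L * M1)"] C c L_nonneg M1 by simp
qed

text \<open>The explicit Euler scheme with step \<open>h\<close>.\<close>

primrec euler :: "real \<Rightarrow> (real \<Rightarrow> real^'j) \<Rightarrow> 'j phase \<Rightarrow> nat \<Rightarrow> 'j phase" where
  "euler h \<zeta> p 0 = p"
| "euler h \<zeta> p (Suc k) = euler h \<zeta> p k + h *\<^sub>R field (\<zeta> (real k * h)) (euler h \<zeta> p k)"

lemma solves_continuous:
  assumes "solves \<zeta> X"
  shows "continuous_on {0..} X"
  unfolding continuous_on_eq_continuous_within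
  using assms by (auto simp: solves_def intro: has_vector_derivative_continuous)

text \<open>
  Here \<open>\<rho>\<close> bounds the oscillation of the velocity of the solution over one step. No rate in \<open>h\<close> is
  available, because the forcing is only continuous.
\<close>

lemma euler_error:
  assumes X: "solves \<zeta> X" and h: "0 \<le> h" and \<Lambda>: "0 \<le> \<Lambda>"
    and lip: "\<And>z x y. norm (field z x - field z y) \<le> \<Lambda> * norm (x - y)"
    and \<rho>: "0 \<le> \<rho>"
    and osc: "\<And>s t. 0 \<le> s \<Longrightarrow> s \<le> t \<Longrightarrow> t \<le> s + h \<Longrightarrow> t \<le> T \<Longrightarrow>
      norm (field (\<zeta> t) (X t) - field (\<zeta> s) (X s)) \<le> \<rho>"
    and "real k * h \<le> T"
  shows "norm (X (real k * h) - euler h \<zeta> (X 0) k) \<le> real k * h * \<rho> * (1 + h * \<Lambda>) ^ k"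
  using assms(7)
proof (induction k)
  case (Suc k)
  define s where "s = real k * h"
  have s: "0 \<le> s" "real (Suc k) * h = s + h" "s + h \<le> T"
    using h Suc.prems by (auto simp: s_def algebra_simps)
  define e where "e = norm (X s - euler h \<zeta> (X 0) k)"
  define F where "F = field (\<zeta> s) (X s)"
  define G where "G = field (\<zeta> s) (euler h \<zeta> (X 0) k)"
  have IH: "e \<le> real k * h * \<rho> * (1 + h * \<Lambda>) ^ k"
    using Suc.IH s h by (simp add: e_def s_def)
  have "norm (X (s + h) - X s - ((s + h) - s) *\<^sub>R field (\<zeta> s) (X s)) \<le> norm ((s + h) - s) * \<rho>"
  proof (rule vector_differentiable_bound_linearization[where S = "{s..s + h}"])
    fix t assume t: "t \<in> {s..s + h}"
    have "(X has_vector_derivative field (\<zeta> t) (X t)) (at t within {0..})"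
      using X t s by (simp add: solves_def)
    then show "(X has_vector_derivative field (\<zeta> t) (X t)) (at t within {s..s + h})"
      by (rule has_vector_derivative_within_subset) (use s in auto)
    show "norm (field (\<zeta> t) (X t) - field (\<zeta> s) (X s)) \<le> \<rho>"
      using osc[of s t] s t by auto
  qed (use h in \<open>auto simp: closed_segment_eq_real_ivl\<close>)
  then have local: "norm (X (s + h) - X s - h *\<^sub>R F) \<le> h * \<rho>" using h by (simp add: F_def)
  have "X (s + h) - euler h \<zeta> (X 0) (Suc k)
      = (X (s + h) - X s - h *\<^sub>R F) + (X s - euler h \<zeta> (X 0) k) + h *\<^sub>R (F - G)"
    by (simp add: G_def s_def algebra_simps)
  then have "norm (X (s + h) - euler h \<zeta> (X 0) (Suc k))
      \<le> norm (X (s + h) - X s - h *\<^sub>R F) + norm (X s - euler h \<zeta> (X 0) k) + norm (h *\<^sub>R (F - G))"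
    by (simp only:) (intro norm_triangle_mono order_refl)
  also have "\<dots> \<le> h * \<rho> + e + h * (\<Lambda> * e)"
  proof -
    have "norm (h *\<^sub>R (F - G)) \<le> h * (\<Lambda> * e)"
      using h lip[of "\<zeta> s" "X s" "euler h \<zeta> (X 0) k"] by (simp add: F_def G_def e_def
          mult_left_mono)
    then show ?thesis using local by (simp add: e_def)
  qed
  also have "\<dots> = h * \<rho> * 1 + (1 + h * \<Lambda>) * e" by (simp add: algebra_simps)
  also have "\<dots> \<le> h * \<rho> * (1 + h * \<Lambda>) ^ Suc k + (1 + h * \<Lambda>) * (real k * h * \<rho> * (1 + h * \<Lambda>) ^ k)"
    using h \<rho> \<Lambda> IH by (intro add_mono mult_left_mono one_le_power) auto
  also have "\<dots> = real (Suc k) * h * \<rho> * (1 + h * \<Lambda>) ^ Suc k"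
    by (simp add: algebra_simps)
  finally show ?case using s by simp
qed simp

lemma euler_converges:
  assumes X: "solves \<zeta> X" and \<zeta>: "continuous_on {0..} \<zeta>" and T: "0 \<le> T"
  shows "(\<lambda>N. euler (T / real N) \<zeta> (X 0) N) \<longlonglongrightarrow> X T"
proof (rule LIMSEQ_I)
  fix \<epsilon> :: real assume \<epsilon>: "0 < \<epsilon>"
  obtain \<Lambda> where \<Lambda>: "0 \<le> \<Lambda>" "\<And>z x y. norm (field z x - field z y) \<le> \<Lambda> * norm (x - y)"
    using field_lipschitz by blast
  define \<rho> where "\<rho> = \<epsilon> / (2 * (T + 1) * exp (\<Lambda> * T))"
  have \<rho>: "0 < \<rho>" using \<epsilon> T by (simp add: \<rho>_def)
  have small: "T * \<rho> * exp (\<Lambda> * T) < \<epsilon>"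
  proof -
    have "T * \<rho> * exp (\<Lambda> * T) = \<epsilon> * (T / (2 * (T + 1)))" by (simp add: \<rho>_def)
    also have "\<dots> < \<epsilon> * 1" using \<epsilon> T by (intro mult_strict_left_mono) auto
    finally show ?thesis by simp
  qed
  define F where "F t = field (\<zeta> t) (X t)" for t
  have "continuous_on {0..T} F"
    unfolding F_def by (intro continuous_field continuous_on_subset[OF \<zeta>] continuous_on_subset[OF
        solves_continuous[OF X]]) auto
  then have "uniformly_continuous_on {0..T} F"
    by (intro compact_uniformly_continuous) auto
  then obtain \<delta> where \<delta>: "0 < \<delta>" "\<And>s t. s \<in> {0..T} \<Longrightarrow> t \<in> {0..T} \<Longrightarrow> dist t s < \<delta> \<Longrightarrow> dist (F t) (F s)
      < \<rho>"
    unfolding uniformly_continuous_on_def using \<rho> by metis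
  obtain N0 :: nat where N0: "T / \<delta> < real N0" using reals_Archimedean2 by blast
  have "norm (euler (T / real N) \<zeta> (X 0) N - X T) < \<epsilon>" if N: "N \<ge> Suc N0" for N
  proof -
    define h where "h = T / real N"
    have Np: "0 < real N" using N by simp
    have h: "0 \<le> h" "real N * h = T" using T Np by (auto simp: h_def)
    have "T / \<delta> < real N" using N0 N by simp
    then have "h < \<delta>" using \<delta>(1) Np by (simp add: h_def field_simps)
    have "norm (X (real N * h) - euler h \<zeta> (X 0) N) \<le> real N * h * \<rho> * (1 + h * \<Lambda>) ^ N"
    proof (rule euler_error[OF X h(1) \<Lambda> less_imp_le[OF \<rho>], where T = T])
      fix s t assume "0 \<le> s" "s \<le> t" "t \<le> s + h" "t \<le> T"
      then show "norm (field (\<zeta> t) (X t) - field (\<zeta> s) (X s)) \<le> \<rho>"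
        using \<delta>(2)[of s t] \<open>h < \<delta>\<close> by (simp add: F_def dist_norm)
    qed (use h in auto)
    also have "\<dots> \<le> T * \<rho> * exp (\<Lambda> * T)"
    proof -
      have "(1 + h * \<Lambda>) ^ N \<le> exp (h * \<Lambda>) ^ N"
        using h \<Lambda> by (intro power_mono) auto
      also have "\<dots> = exp (\<Lambda> * T)"
        unfolding exp_of_nat_mult[symmetric] h(2)[symmetric] by (simp add: mult_ac)
      finally show ?thesis using h T \<rho> by (simp add: mult_left_mono)
    qed
    also note small
    finally show ?thesis unfolding h(2) by (simp add: h_def norm_minus_commute)
  qed
  then show "\<exists>no. \<forall>n\<ge>no. norm (euler (T / real n) \<zeta> (X 0) n - X T) < \<epsilon>" by blast
qed

lemma solution_measurable:
  assumes \<zeta>: "\<And>s. (\<lambda>\<omega>. \<zeta> \<omega> s) \<in> borel_measurable M"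
    and cont: "\<And>\<omega>. \<omega> \<in> space M \<Longrightarrow> continuous_on {0..} (\<zeta> \<omega>)"
    and X: "\<And>\<omega>. \<omega> \<in> space M \<Longrightarrow> solves (\<zeta> \<omega>) (X \<omega>)" "\<And>\<omega>. \<omega> \<in> space M \<Longrightarrow> X \<omega> 0 = p"
    and T: "0 \<le> T"
  shows "(\<lambda>\<omega>. X \<omega> T) \<in> borel_measurable M"
proof (rule borel_measurable_LIMSEQ_metric)
  have "(\<lambda>x. field (fst x) (snd x)) \<in> borel_measurable (borel \<Otimes>\<^sub>M borel)"
    unfolding borel_prod by (intro borel_measurable_continuous_onI continuous_field
        continuous_intros)
  note field_meas = this
  have meas: "(\<lambda>\<omega>. field (z \<omega>) (y \<omega>)) \<in> borel_measurable M"
    if "z \<in> borel_measurable M" "y \<in> borel_measurable M" for z y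
    using measurable_compose[OF measurable_Pair[OF that] field_meas] by (simp only: fst_conv
        snd_conv)
  have "(\<lambda>\<omega>. euler h (\<zeta> \<omega>) p k) \<in> borel_measurable M" for h k
    by (induction k) (simp_all add: borel_measurable_add borel_measurable_scaleR meas \<zeta>)
  then show "(\<lambda>\<omega>. euler (T / real N) (\<zeta> \<omega>) p N) \<in> borel_measurable M" for N .
  show "(\<lambda>N. euler (T / real N) (\<zeta> \<omega>) p N) \<longlonglongrightarrow> X \<omega> T" if "\<omega> \<in> space M" for \<omega>
    using euler_converges[OF X(1)[OF that] cont[OF that] T] unfolding X(2)[OF that] .
qed

end

lemma path_evaluation_measurable:
  assumes W: "two_sided_wiener W"
  shows "(\<lambda>w. w s) \<in> borel_measurable W"
proof -
  have incr: "(\<lambda>w. w t - w s) \<in> borel_measurable W" if "s < t" for s t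
  proof -
    have "distributed W lborel (\<lambda>w. w t - w s) (normal_density 0 (sqrt (t - s)))"
      using W that by (simp add: two_sided_wiener_def)
    from distributed_measurable[OF this] show ?thesis by simp
  qed
  have w0: "w 0 = 0" if "w \<in> space W" for w
    using W that by (simp add: two_sided_wiener_def path_space_def)
  consider "s < 0" | "s = 0" | "0 < s" by linarith
  then show ?thesis
  proof cases
    case 1
    then have "(\<lambda>w. - (w 0 - w s)) \<in> borel_measurable W" by (intro borel_measurable_uminus incr)
    then show ?thesis by (rule measurable_cong[THEN iffD1, rotated]) (simp add: w0)
  next
    case 2
    have "(\<lambda>w. 0 :: real) \<in> borel_measurable W" by simp
    then show ?thesis by (rule measurable_cong[THEN iffD1, rotated]) (simp add: w0 2)
  next
    case 3
    then have "(\<lambda>w. w s - w 0) \<in> borel_measurable W" by (rule incr)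
    then show ?thesis by (rule measurable_cong[THEN iffD1, rotated]) (simp add: w0)
  qed
qed

lemma noise_evaluation_measurable:
  fixes j :: "'j::finite"
  assumes W: "two_sided_wiener W"
  shows "(\<lambda>\<omega>. \<omega> j s) \<in> borel_measurable (noise_space W :: 'j noise measure)"
  unfolding noise_space_def
  by (rule measurable_compose[OF measurable_component_singleton[of j UNIV "\<lambda>_. W"]
      path_evaluation_measurable[OF W]]) simp

text \<open>
  Joint measurability of a random path in noise and time follows from continuity in time, by
  evaluation on the grid of mesh \<open>1 / Suc n\<close>.
\<close>

lemma noise_jointly_measurable:
  fixes j :: "'j::finite"
  assumes W: "two_sided_wiener W"
  shows "(\<lambda>x. fst x j (snd x + t)) \<in> borel_measurable ((noise_space W :: 'j noise measure) \<Otimes>\<^sub>M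
      lborel)"
    (is "_ \<in> borel_measurable ?M")
proof (rule borel_measurable_LIMSEQ_metric)
  fix n :: nat
  have "(\<lambda>x. fst x j (real_of_int i / real (Suc n))) \<in> borel_measurable ?M" for i :: int
    by (rule measurable_compose[OF measurable_fst noise_evaluation_measurable[OF W]])
  moreover have "(\<lambda>x. \<lfloor>real (Suc n) * (snd x + t)\<rfloor>) \<in> measurable ?M (count_space UNIV)"
    by (rule measurable_compose[OF _ measurable_real_floor]) simp
  ultimately show "(\<lambda>x. fst x j (real_of_int \<lfloor>real (Suc n) * (snd x + t)\<rfloor> / real (Suc n))) \<in>
      borel_measurable ?M"
    by (rule measurable_compose_countable)
next
  fix x assume "x \<in> space ?M"
  then have "continuous_on UNIV (fst x j)"
    using W by (auto simp: space_pair_measure noise_space_def space_PiM two_sided_wiener_def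
        path_space_def PiE_iff)
  then have "isCont (fst x j) (snd x + t)" by (simp add: continuous_on_eq_continuous_at)
  moreover have "(\<lambda>n. real_of_int \<lfloor>real (Suc n) * r\<rfloor> / real (Suc n)) \<longlonglongrightarrow> r" for r :: real
  proof (rule tendsto_sandwich)
    have "(\<lambda>n. r - inverse (real (Suc n))) \<longlonglongrightarrow> r - 0"
      by (intro tendsto_intros LIMSEQ_inverse_real_of_nat)
    then show "(\<lambda>n. r - inverse (real (Suc n))) \<longlonglongrightarrow> r" by simp
    have "r - inverse (real (Suc n)) \<le> real_of_int \<lfloor>real (Suc n) * r\<rfloor> / real (Suc n)" for n
    proof -
      have "real (Suc n) * r - 1 \<le> real_of_int \<lfloor>real (Suc n) * r\<rfloor>" by linarith
      then have "(real (Suc n) * r - 1) / real (Suc n) \<le> real_of_int \<lfloor>real (Suc n) * r\<rfloor> / real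
          (Suc n)"
        by (rule divide_right_mono) simp
      then show ?thesis by (simp add: diff_divide_distrib inverse_eq_divide del: of_nat_Suc)
    qed
    then show "\<forall>\<^sub>F n in sequentially. r - inverse (real (Suc n)) \<le> real_of_int \<lfloor>real (Suc n) * r\<rfloor>
        / real (Suc n)"
      by simp
    have "real_of_int \<lfloor>real (Suc n) * r\<rfloor> / real (Suc n) \<le> r" for n
    proof -
      have "real_of_int \<lfloor>real (Suc n) * r\<rfloor> \<le> r * real (Suc n)"
        using of_int_floor_le[of "real (Suc n) * r"] by (simp only: mult.commute)
      then show ?thesis by (simp only: pos_divide_le_eq of_nat_0_less_iff zero_less_Suc)
    qed
    then show "\<forall>\<^sub>F n in sequentially. real_of_int \<lfloor>real (Suc n) * r\<rfloor> / real (Suc n) \<le> r"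
      by simp
  qed simp
  ultimately show "(\<lambda>n. fst x j (real_of_int \<lfloor>real (Suc n) * (snd x + t)\<rfloor> / real (Suc n))) \<longlonglongrightarrow> fst x
      j (snd x + t)"
    by (rule isCont_tendsto_compose)
qed

lemma ou_measurable:
  fixes eps :: "real^'j::finite"
  assumes W: "two_sided_wiener W"
  shows "(\<lambda>\<omega>. ou eps (shift t \<omega>)) \<in> borel_measurable (noise_space W)"
  unfolding borel_measurable_euclidean_space[where f = "\<lambda>\<omega>. ou eps (shift t \<omega>)"]
proof
  fix b :: "real^'j" assume "b \<in> Basis"
  then obtain j where b: "b = axis j 1" by (auto simp: Basis_vec_def)
  have joint: "(\<lambda>x. fst x j (snd x + t)) \<in> borel_measurable (noise_space W \<Otimes>\<^sub>M lborel)"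
    by (rule noise_jointly_measurable[OF W])
  have fixed: "(\<lambda>x. fst x j t) \<in> borel_measurable (noise_space W \<Otimes>\<^sub>M lborel)"
    by (rule measurable_compose[OF measurable_fst noise_evaluation_measurable[OF W]])
  have "(\<lambda>x. indicator {..0::real} (snd x) *\<^sub>R (exp (snd x) * (fst x j (snd x + t) - fst x j t)))
      \<in> borel_measurable (noise_space W \<Otimes>\<^sub>M lborel)"
    using joint fixed by measurable
  then have "(\<lambda>\<omega>. \<integral>s. indicator {..0} s *\<^sub>R (exp s * (\<omega> j (s + t) - \<omega> j t)) \<partial>lborel) \<in>
      borel_measurable (noise_space W)"
    by (intro lborel.borel_measurable_lebesgue_integral) (simp add: case_prod_beta')
  then show "(\<lambda>\<omega>. ou eps (shift t \<omega>) \<bullet> b) \<in> borel_measurable (noise_space W)"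
    by (simp add: b inner_axis ou_def shift_def set_lebesgue_integral_def)
qed

lemma shift_shift: "shift s (shift t \<omega>) = shift (s + t) \<omega>"
  by (simp add: shift_def fun_eq_iff add.assoc)


section \<open>Pullback dynamics and the limit set\<close>

text \<open>
  The solution map \<open>Y\<close> driven by the stationary process, whose growth along the shift is bounded in
  terms of the random variable \<open>r\<close>.
\<close>

locale random_system = damped_system A \<alpha> K \<delta> lam1 \<beta> f g \<kappa> c1 c2 M1 L
  for A :: "real^'j^'j::finite" and \<alpha> K \<delta> lam1 \<beta> :: real and f :: "real^'j" and g :: "real \<Rightarrow> real"
    and \<kappa> c1 c2 M1 L :: real +
  fixes W :: "(real \<Rightarrow> real) measure" and eps :: "real^'j" and \<Omega> :: "'j noise set"
    and Y :: "real \<Rightarrow> 'j noise \<Rightarrow> 'j phase \<Rightarrow> 'j phase" and r :: "'j noise \<Rightarrow> real"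
  assumes wiener: "two_sided_wiener W" and good: "good_noise_set W eps \<Omega>"
    and sol: "solution_map A \<alpha> K \<beta> f g eps \<Omega> Y"
    and r_pos: "\<And>\<omega>. \<omega> \<in> \<Omega> \<Longrightarrow> 0 < r \<omega>"
    and ou_bound: "\<And>\<omega> t. \<omega> \<in> \<Omega> \<Longrightarrow> norm (ou eps (shift t \<omega>)) \<le> exp (rate / 2 * \<bar>t\<bar>) * r \<omega>"
    and r_shift: "\<And>\<omega> t. \<omega> \<in> \<Omega> \<Longrightarrow> r (shift t \<omega>) \<le> exp (rate / 2 * \<bar>t\<bar>) * r \<omega>"
begin

abbreviation p0 :: "'j phase" where "p0 \<equiv> \<kappa> *\<^sub>R eta0"

abbreviation noise_M :: "'j noise measure" where "noise_M \<equiv> restrict_space (noise_space W) \<Omega>"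

abbreviation R :: "'j noise \<Rightarrow> real" where "R \<equiv> absorbing_radius \<alpha> \<beta> f rate c1 M1 r"

lemma R_eq: "R \<omega> = 4 * a1 / rate * r \<omega> + 2 * a2 / rate"
  by (simp add: absorbing_radius_def a1_def a2_def Let_def)

lemma p0_eq: "p0 = (vec \<kappa>, 0)"
  by (simp add: eta0_def vec_eq_iff)

lemma coord_p0 [simp]: "coord eta0 = 1"
  by (simp add: phase_coord_def eta0_def)

lemma P_p0 [simp]: "P (y + t *\<^sub>R p0) = P y + t *\<^sub>R p0" and Q_p0 [simp]: "Q (y + t *\<^sub>R p0) = Q y"
  by (auto simp: P_eq Q_E2_def p0_eq vec_eq_iff prod_eq_iff algebra_simps phase_coord_def)

lemma shift_in: "\<omega> \<in> \<Omega> \<Longrightarrow> shift t \<omega> \<in> \<Omega>"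
  using good by (auto simp: good_noise_set_def)

lemma Y_0 [simp]: "\<omega> \<in> \<Omega> \<Longrightarrow> Y 0 \<omega> y = y"
  using sol unfolding solution_map_def by blast

lemma Y_solves: "\<omega> \<in> \<Omega> \<Longrightarrow> solves (\<lambda>t. ou eps (shift t \<omega>)) (\<lambda>t. Y t \<omega> y)"
  using sol unfolding solution_map_def solves_def by blast

lemma Y_cocycle:
  assumes "\<omega> \<in> \<Omega>" "0 \<le> s" "0 \<le> t"
  shows "Y (t + s) \<omega> y = Y t (shift s \<omega>) (Y s \<omega> y)"
proof (rule solves_unique[OF _ _ _ \<open>0 \<le> t\<close>])
  show "solves (\<lambda>t. ou eps (shift (t + s) \<omega>)) (\<lambda>t. Y (t + s) \<omega> y)"
    by (rule solves_shift[OF Y_solves]) (use assms in auto)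
  show "solves (\<lambda>t. ou eps (shift (t + s) \<omega>)) (\<lambda>t. Y t (shift s \<omega>) (Y s \<omega> y))"
    using Y_solves[OF shift_in[OF assms(1)]] by (simp add: shift_shift)
qed (use assms shift_in in simp)

lemma Y_translate:
  assumes "\<omega> \<in> \<Omega>" "0 \<le> t"
  shows "Y t \<omega> (y + of_int k *\<^sub>R p0) = Y t \<omega> y + of_int k *\<^sub>R p0"
  by (rule solves_unique[OF Y_solves solves_translate[OF Y_solves]]) (use assms in auto)

text \<open>The state at time \<open>0\<close> of the solution that starts at time \<open>- t\<close>.\<close>

definition pull :: "real \<Rightarrow> 'j noise \<Rightarrow> 'j phase \<Rightarrow> 'j phase" where
  "pull t \<omega> y = Y t (shift (- t) \<omega>) y"

lemma pull_compose:
  assumes "\<omega> \<in> \<Omega>" "0 \<le> t" "t \<le> \<tau>"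
  shows "pull \<tau> \<omega> y = pull t \<omega> (pull (\<tau> - t) (shift (- t) \<omega>) y)"
  using Y_cocycle[OF shift_in[OF assms(1), of "- \<tau>"], of "\<tau> - t" t y] assms
  by (simp add: pull_def shift_shift)

lemma pull_translate:
  assumes "\<omega> \<in> \<Omega>" "0 \<le> t"
  shows "pull t \<omega> (y + of_int k *\<^sub>R p0) = pull t \<omega> y + of_int k *\<^sub>R p0"
  unfolding pull_def by (rule Y_translate[OF shift_in[OF assms(1)] assms(2)])

lemma pull_lipschitz:
  assumes "\<omega> \<in> \<Omega>" "0 \<le> t"
  shows "nrm (pull t \<omega> x - pull t \<omega> y) \<le> exp (L * t) * nrm (x - y)"
  using solves_lipschitz[OF Y_solves Y_solves assms(2), OF shift_in shift_in, OF assms(1) assms(1)]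
    shift_in[OF assms(1)] by (simp add: pull_def)

lemma pull_squeezing:
  assumes "\<omega> \<in> \<Omega>" "0 \<le> t"
  shows "nrm (Q (pull t \<omega> x - pull t \<omega> y))
    \<le> nrm (P (pull t \<omega> x - pull t \<omega> y)) + exp (- (rate - 2 * L) * t) * nrm (Q (x - y))"
  using cone_squeezing[OF Y_solves Y_solves assms(2), OF shift_in shift_in, OF assms(1) assms(1)]
    shift_in[OF assms(1)] by (simp add: pull_def)

lemma continuous_pull:
  assumes "\<omega> \<in> \<Omega>" "0 \<le> t"
  shows "continuous_on S (pull t \<omega>)"
proof -
  define c where "c = 2 / \<alpha> + 2"
  have c: "0 < c" using alpha by (simp add: c_def add_pos_pos)
  have "dist (pull t \<omega> x) (pull t \<omega> y) \<le> (c * exp (L * t) * M1) * dist x y" for x y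
  proof -
    have "norm (pull t \<omega> x - pull t \<omega> y) \<le> c * nrm (pull t \<omega> x - pull t \<omega> y)"
      unfolding c_def by (rule norm_le_nrm)
    also have "\<dots> \<le> c * (exp (L * t) * nrm (x - y))"
      using c pull_lipschitz[OF assms] by (intro mult_left_mono) auto
    also have "\<dots> \<le> c * (exp (L * t) * (M1 * norm (x - y)))"
      using c M1(2)[of "x - y"] by (intro mult_left_mono) auto
    finally show ?thesis by (simp add: dist_norm mult_ac)
  qed
  then have "(c * exp (L * t) * M1)-lipschitz_on S (pull t \<omega>)"
    using c M1 by (intro lipschitz_onI) auto
  then show ?thesis by (rule lipschitz_on_continuous_on)
qed

lemma R_nonneg: "\<omega> \<in> \<Omega> \<Longrightarrow> 0 \<le> R \<omega>"
  using a1_nonneg a2_nonneg rate_pos r_pos[of \<omega>] by (simp add: R_eq)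

lemma R_shift:
  assumes "\<omega> \<in> \<Omega>" "0 \<le> t"
  shows "R (shift (- t) \<omega>) \<le> exp (rate / 2 * t) * R \<omega>"
proof -
  have "4 * a1 / rate * r (shift (- t) \<omega>) \<le> 4 * a1 / rate * (exp (rate / 2 * t) * r \<omega>)"
    using r_shift[OF assms(1), of "- t"] assms(2) a1_nonneg rate_pos by (intro mult_left_mono) auto
  moreover have "1 * (2 * a2 / rate) \<le> exp (rate / 2 * t) * (2 * a2 / rate)"
    using a2_nonneg rate_pos assms(2) by (intro mult_right_mono) auto
  ultimately show ?thesis by (simp add: R_eq algebra_simps)
qed

text \<open>
  Comparison of the factor \<open>exp (- rate * t)\<close> with the growth \<open>exp (rate / 2 * t)\<close> of the radius
  yields the bound \<open>3 / 2 * R \<omega>\<close>, rounded up here.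
\<close>

lemma pull_absorbed:
  assumes \<omega>: "\<omega> \<in> \<Omega>" and t: "0 \<le> t" and y: "nrm (Q y) \<le> R (shift (- t) \<omega>)"
  shows "nrm (Q (pull t \<omega> y)) \<le> 2 * R \<omega>"
proof -
  have "nrm (Q (Y t (shift (- t) \<omega>) y))
      \<le> exp (- rate * t) * nrm (Q (Y 0 (shift (- t) \<omega>) y)) + (2 * a1 / rate * r \<omega> + a2 / rate)"
  proof (rule absorption[OF Y_solves[OF shift_in[OF \<omega>]] t less_imp_le[OF r_pos[OF \<omega>]]])
    fix s assume "0 \<le> s" "s \<le> t"
    then show "norm (ou eps (shift s (shift (- t) \<omega>))) \<le> exp (rate / 2 * (t - s)) * r \<omega>"
      using ou_bound[OF \<omega>, of "s - t"] by (simp add: shift_shift)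
  qed
  also have "\<dots> = exp (- rate * t) * nrm (Q y) + R \<omega> / 2"
    using shift_in[OF \<omega>, of "- t"] rate_pos by (simp add: R_eq field_simps)
  also have "exp (- rate * t) * nrm (Q y) \<le> exp (- rate * t) * (exp (rate / 2 * t) * R \<omega>)"
    using y R_shift[OF \<omega> t] by (intro mult_left_mono) auto
  also have "\<dots> = exp (- (rate / 2 * t)) * R \<omega>"
    by (simp add: mult.assoc[symmetric] mult_exp_exp)
  also have "\<dots> \<le> 1 * R \<omega>"
    using rate_pos t R_nonneg[OF \<omega>] by (intro mult_right_mono) auto
  finally show ?thesis using R_nonneg[OF \<omega>] by (simp add: pull_def)
qed

text \<open>
  The lift to \<open>E\<close> of the pullback images of the absorbing set over all times from \<open>t\<close> on, and the
  pullback limit set of these lifts.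
\<close>

definition tail :: "real \<Rightarrow> 'j noise \<Rightarrow> 'j phase set" where
  "tail t \<omega> = {pull \<tau> \<omega> y | \<tau> y. t \<le> \<tau> \<and> nrm (Q y) \<le> R (shift (- \<tau>) \<omega>)}"

definition limit_set :: "'j noise \<Rightarrow> 'j phase set" where
  "limit_set \<omega> = (\<Inter>t\<in>{0<..}. closure (tail t \<omega>))"

lemma tail_mono: "s \<le> t \<Longrightarrow> tail t \<omega> \<subseteq> tail s \<omega>"
  by (force simp: tail_def)

lemma tail_translate:
  assumes "\<omega> \<in> \<Omega>" "0 \<le> t" "x \<in> tail t \<omega>"
  shows "x + of_int k *\<^sub>R p0 \<in> tail t \<omega>"
proof -
  obtain \<tau> y where x: "x = pull \<tau> \<omega> y" "t \<le> \<tau>" "nrm (Q y) \<le> R (shift (- \<tau>) \<omega>)"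
    using assms(3) by (auto simp: tail_def)
  then have "x + of_int k *\<^sub>R p0 = pull \<tau> \<omega> (y + of_int k *\<^sub>R p0)"
    using pull_translate[OF assms(1)] assms(2) by simp
  moreover have "Q (y + of_int k *\<^sub>R p0) = Q y" by (rule Q_p0)
  ultimately show ?thesis unfolding tail_def using x by (metis (mono_tags, lifting) mem_Collect_eq)
qed

text \<open>A bound for the deviation from the cone of two points of the tail.\<close>

definition err :: "real \<Rightarrow> 'j noise \<Rightarrow> real" where
  "err t \<omega> = 4 * exp (- (rate / 2 - 2 * L) * t) * R \<omega>"

lemma err_tendsto: "(\<lambda>n. err (real n) \<omega>) \<longlonglongrightarrow> 0"
proof -
  define c where "c = rate / 2 - 2 * L"
  have "0 < c" using rate_gt by (simp add: c_def)
  then have "(\<lambda>n. exp (- c) ^ n) \<longlonglongrightarrow> 0" by (intro LIMSEQ_power_zero) simp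
  moreover have "exp (- c) ^ n = exp (- c * real n)" for n
    by (simp add: exp_of_nat_mult[symmetric] mult.commute)
  ultimately have "(\<lambda>n. 4 * exp (- c * real n) * R \<omega>) \<longlonglongrightarrow> 4 * 0 * R \<omega>"
    by (intro tendsto_intros) simp
  then show ?thesis by (simp add: err_def c_def)
qed

text \<open>
  Points of the tail are images under \<open>pull t \<omega>\<close> of points whose \<open>E2\<close>-part is at most
  \<open>2 * R (shift (- t) \<omega>)\<close>. By the growth bound on the absorbing radius, the squeezing rate
  \<open>rate - 2 * L\<close> is reduced to \<open>rate / 2 - 2 * L\<close>, which is positive.
\<close>

lemma tail_squeezing:
  assumes \<omega>: "\<omega> \<in> \<Omega>" and t: "0 \<le> t" and "x \<in> tail t \<omega>" "y \<in> tail t \<omega>"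
  shows "nrm (Q (x - y)) \<le> nrm (P (x - y)) + err t \<omega>"
proof -
  have rep: "\<exists>x'. x = pull t \<omega> x' \<and> nrm (Q x') \<le> 2 * (exp (rate / 2 * t) * R \<omega>)" if x: "x \<in> tail t
      \<omega>" for x
  proof -
    obtain \<tau> y where x: "x = pull \<tau> \<omega> y" "t \<le> \<tau>" "nrm (Q y) \<le> R (shift (- \<tau>) \<omega>)"
      using x by (auto simp: tail_def)
    let ?x = "pull (\<tau> - t) (shift (- t) \<omega>) y"
    have "nrm (Q ?x) \<le> 2 * R (shift (- t) \<omega>)"
      by (rule pull_absorbed[OF shift_in[OF \<omega>]]) (use x in \<open>auto simp: shift_shift\<close>)
    moreover have "x = pull t \<omega> ?x" using pull_compose[OF \<omega> t x(2)] x(1) by simp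
    ultimately show ?thesis using R_shift[OF \<omega> t] by (intro exI[of _ ?x]) auto
  qed
  obtain x' where x': "x = pull t \<omega> x'" "nrm (Q x') \<le> 2 * (exp (rate / 2 * t) * R \<omega>)"
    using rep assms by blast
  obtain y' where y': "y = pull t \<omega> y'" "nrm (Q y') \<le> 2 * (exp (rate / 2 * t) * R \<omega>)"
    using rep assms by blast
  have "nrm (Q (x' - y')) \<le> 4 * (exp (rate / 2 * t) * R \<omega>)"
    using nrm_triangle_diff[of "Q x'" "Q y'"] x' y' by (simp add: Q_diff)
  then have "exp (- (rate - 2 * L) * t) * nrm (Q (x' - y')) \<le> exp (- (rate - 2 * L) * t) * (4 *
      (exp (rate / 2 * t) * R \<omega>))"
    by (intro mult_left_mono) auto
  also have "\<dots> = err t \<omega>"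
  proof -
    have "exp (- (rate - 2 * L) * t) * exp (rate / 2 * t) = exp (- (rate / 2 - 2 * L) * t)"
      unfolding mult_exp_exp by (rule arg_cong[of _ _ exp]) (simp add: field_simps)
    then show ?thesis by (simp add: err_def)
  qed
  finally show ?thesis using pull_squeezing[OF \<omega> t, of x' y'] x' y' by simp
qed

lemma continuous_on_P [continuous_intros]:
  "continuous_on S h \<Longrightarrow> continuous_on S (\<lambda>x. P (h x))"
  using continuous_on_diff[of S h "\<lambda>x. Q (h x)"] continuous_on_Q[of S h] by (simp add: Q_E2_def)

lemma closure_tail_squeezing:
  assumes \<omega>: "\<omega> \<in> \<Omega>" and t: "0 \<le> t" and "x \<in> closure (tail t \<omega>)" "y \<in> closure (tail t \<omega>)"
  shows "nrm (Q (x - y)) \<le> nrm (P (x - y)) + err t \<omega>"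
proof -
  define C where "C = {p. nrm (Q (fst p - snd p)) \<le> nrm (P (fst p - snd p)) + err t \<omega>}"
  have "closed C" unfolding C_def by (intro closed_Collect_le continuous_intros)
  moreover have "tail t \<omega> \<times> tail t \<omega> \<subseteq> C" using tail_squeezing[OF \<omega> t] by (auto simp: C_def)
  ultimately have "closure (tail t \<omega> \<times> tail t \<omega>) \<subseteq> C" by (rule closure_minimal[rotated])
  then have "(x, y) \<in> C" using assms by (auto simp: closure_Times)
  then show ?thesis by (simp add: C_def)
qed

lemma limit_set_in_cone:
  assumes \<omega>: "\<omega> \<in> \<Omega>" and x: "x \<in> limit_set \<omega>" and y: "y \<in> limit_set \<omega>"
  shows "nrm (Q (x - y)) \<le> nrm (P (x - y))"
proof (rule LIMSEQ_le_const)
  show "(\<lambda>n. nrm (P (x - y)) + err (real n) \<omega>) \<longlonglongrightarrow> nrm (P (x - y))"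
    using tendsto_add[OF tendsto_const err_tendsto] by simp
  show "\<exists>N. \<forall>n\<ge>N. nrm (Q (x - y)) \<le> nrm (P (x - y)) + err (real n) \<omega>"
    by (intro exI[of _ 1] allI impI closure_tail_squeezing[OF \<omega>]) (use x y in \<open>auto simp:
        limit_set_def\<close>)
qed

text \<open>The image at time \<open>0\<close> of the curve \<open>E1\<close> started at time \<open>- t\<close>.\<close>

definition curve :: "real \<Rightarrow> 'j noise \<Rightarrow> real \<Rightarrow> 'j phase" where
  "curve t \<omega> s = pull t \<omega> (vec s, 0)"

lemma curve_in_tail:
  assumes "\<omega> \<in> \<Omega>"
  shows "curve t \<omega> s \<in> tail t \<omega>"
proof -
  have "Q (vec s, 0) = 0" by (simp add: Q_eq)
  then have "nrm (Q (vec s, 0)) \<le> R (shift (- t) \<omega>)"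
    using R_nonneg[OF shift_in[OF assms]] by simp
  then show ?thesis unfolding tail_def curve_def by blast
qed

lemma continuous_curve:
  assumes "\<omega> \<in> \<Omega>" "0 \<le> t"
  shows "continuous_on S (curve t \<omega>)"
proof -
  have "continuous_on S (\<lambda>s. (vec s, 0) :: 'j phase)"
    unfolding vec_def by (intro continuous_intros continuous_on_vec_lambda)
  then show ?thesis
    unfolding curve_def by (rule continuous_on_compose2[OF continuous_pull[OF assms]]) auto
qed

text \<open>
  The \<open>E1\<close>-coordinate along the curve is continuous and increases by \<open>\<kappa>\<close> over one period,
  hence takes all values.
\<close>

lemma curve_surjective:
  assumes \<omega>: "\<omega> \<in> \<Omega>" and t: "0 \<le> t"
  obtains s where "coord (curve t \<omega> s) = p"
proof -
  define h where "h s = coord (curve t \<omega> s)" for s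
  have per: "h (of_int k * \<kappa>) = h 0 + of_int k * \<kappa>" for k
  proof -
    have "(vec (of_int k * \<kappa>), 0 :: real^'j) = (vec 0, 0) + of_int k *\<^sub>R p0"
      by (simp add: p0_eq vec_eq_iff)
    then show ?thesis
      unfolding h_def curve_def using pull_translate[OF \<omega> t, of "(vec 0, 0)" k] by simp
  qed
  obtain m :: nat where "\<bar>p - h 0\<bar> / \<kappa> < real m" using reals_Archimedean2 by blast
  then have "\<bar>p - h 0\<bar> < real m * \<kappa>" using period(1) by (simp add: field_simps)
  then have "h (of_int (- int m) * \<kappa>) \<le> p" "p \<le> h (of_int (int m) * \<kappa>)"
    unfolding per by auto
  moreover have "of_int (- int m) * \<kappa> \<le> of_int (int m) * \<kappa>"
    using period(1) by (intro mult_right_mono) auto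
  moreover have "continuous_on {of_int (- int m) * \<kappa>..of_int (int m) * \<kappa>} h"
    unfolding h_def by (intro continuous_intros continuous_curve \<omega> t)
  ultimately obtain s where "h s = p" using IVT'[of h] by blast
  then show ?thesis using that by (simp add: h_def)
qed

lemma same_coord_nrm: "coord x = coord y \<Longrightarrow> nrm (x - y) = nrm (Q (x - y)) \<and> nrm (P (x - y)) = 0"
  by (simp add: Q_eq P_eq zero_prod_def[symmetric])

text \<open>
  The limit set meets every fibre of the projection on \<open>E1\<close>, in the limit of the points of the curves
  from times \<open>- n\<close> in that fibre.
\<close>

lemma limit_set_point:
  assumes \<omega>: "\<omega> \<in> \<Omega>"
  obtains y where "y \<in> limit_set \<omega>" "coord y = p"
proof -
  have "\<exists>s. coord (curve (real n) \<omega> s) = p" for n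
    using curve_surjective[OF \<omega>, of "real n" p] by auto
  then obtain s where s: "\<And>n. coord (curve (real n) \<omega> (s n)) = p" by metis
  define y where "y n = curve (real n) \<omega> (s n)" for n
  define c where "c = 2 / \<alpha> + 2"
  have c: "0 < c" using alpha by (simp add: c_def add_pos_pos)
  have tail: "y m \<in> tail (real n) \<omega>" if "n \<le> m" for n m
    using curve_in_tail[OF \<omega>] tail_mono[of "real n" "real m"] that by (auto simp: y_def)
  have close: "norm (y n - y m) \<le> c * err (real n) \<omega>" if "n \<le> m" for n m
  proof -
    have "nrm (y n - y m) \<le> err (real n) \<omega>"
      using tail_squeezing[OF \<omega> _ tail[of n n] tail[OF that]] same_coord_nrm[of "y n" "y m"] s
      by (simp add: y_def)
    then have "c * nrm (y n - y m) \<le> c * err (real n) \<omega>" using c by simp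
    then show ?thesis using norm_le_nrm[of "y n - y m"] by (simp add: c_def)
  qed
  have "Cauchy y"
  proof (rule CauchyI')
    fix e :: real assume e: "0 < e"
    have "(\<lambda>n. c * err (real n) \<omega>) \<longlonglongrightarrow> c * 0" by (intro tendsto_intros err_tendsto)
    then have "\<forall>\<^sub>F n in sequentially. c * err (real n) \<omega> < e" using e by (intro order_tendstoD) auto
    then obtain N where N: "\<And>n. n \<ge> N \<Longrightarrow> c * err (real n) \<omega> < e"
      by (auto simp: eventually_sequentially)
    have "dist (y m) (y n) < e" if "m \<ge> N" "n > m" for m n
      using close[of m n] N[of m] that by (simp add: dist_norm)
    then show "\<exists>M. \<forall>m\<ge>M. \<forall>n>m. dist (y m) (y n) < e" by blast
  qed
  then obtain l where l: "y \<longlonglongrightarrow> l" by (metis Cauchy_convergent convergent_def)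
  have "l \<in> closure (tail t \<omega>)" if "0 < t" for t
  proof -
    obtain n where n: "t < real n" using reals_Archimedean2 by blast
    have "y (k + n) \<in> tail t \<omega>" for k
      using tail[of n "k + n"] tail_mono[of t "real n"] n by auto
    then show ?thesis
      unfolding closure_sequential
      using LIMSEQ_ignore_initial_segment[OF l, of n] by (intro exI[of _ "\<lambda>k. y (k + n)"]) auto
  qed
  moreover have "coord l = p"
  proof -
    have cont: "continuous_on UNIV coord" by (intro continuous_intros)
    have "(\<lambda>n. coord (y n)) \<longlonglongrightarrow> coord l"
      by (rule continuous_on_tendsto_compose[OF cont l]) auto
    then show ?thesis using s by (simp add: y_def LIMSEQ_const_iff)
  qed
  ultimately show ?thesis by (intro that[of l]) (simp_all add: limit_set_def)
qed

lemma limit_set_curve_close: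
  assumes \<omega>: "\<omega> \<in> \<Omega>" and y: "y \<in> limit_set \<omega>" and t: "0 < t" and "coord (curve t \<omega> s) = coord y"
  shows "nrm (curve t \<omega> s - y) \<le> err t \<omega>"
proof -
  have "curve t \<omega> s \<in> closure (tail t \<omega>)"
    using curve_in_tail[OF \<omega>] closure_subset by blast
  moreover have "y \<in> closure (tail t \<omega>)" using y t by (auto simp: limit_set_def)
  ultimately have "nrm (Q (curve t \<omega> s - y)) \<le> nrm (P (curve t \<omega> s - y)) + err t \<omega>"
    using closure_tail_squeezing[OF \<omega>] t by simp
  then show ?thesis using same_coord_nrm[OF assms(4)] by simp
qed

lemma limit_set_translate:
  assumes \<omega>: "\<omega> \<in> \<Omega>" and y: "y \<in> limit_set \<omega>"
  shows "y + p0 \<in> limit_set \<omega>"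
  unfolding limit_set_def
proof
  fix t :: real assume "t \<in> {0<..}"
  then have t: "0 < t" by simp
  have "(+) p0 ` tail t \<omega> \<subseteq> tail t \<omega>"
    using tail_translate[OF \<omega>, of t _ 1] t by (auto simp: add.commute)
  then have "(+) p0 ` closure (tail t \<omega>) \<subseteq> closure (tail t \<omega>)"
    by (metis closure_mono closure_translation)
  moreover have "y \<in> closure (tail t \<omega>)" using y t by (auto simp: limit_set_def)
  ultimately show "y + p0 \<in> closure (tail t \<omega>)" by (auto simp: add.commute)
qed

lemma space_noise_M: "space noise_M = \<Omega>"
  using good sets.sets_into_space[of \<Omega> "noise_space W"]
  by (auto simp: space_restrict_space good_noise_set_def)

lemma curve_measurable:
  assumes "0 \<le> t"
  shows "(\<lambda>\<omega>. curve t \<omega> s) \<in> borel_measurable noise_M"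
  unfolding curve_def pull_def
proof (rule solution_measurable[where X = "\<lambda>\<omega> q. Y q (shift (- t) \<omega>) (vec s, 0)"
      and \<zeta> = "\<lambda>\<omega> q. ou eps (shift q (shift (- t) \<omega>))" and p = "(vec s, 0)"])
  show "(\<lambda>\<omega>. ou eps (shift q (shift (- t) \<omega>))) \<in> borel_measurable noise_M" for q
    unfolding shift_shift by (intro measurable_restrict_space1 ou_measurable[OF wiener])
  fix \<omega> assume "\<omega> \<in> space noise_M"
  then have \<omega>: "shift (- t) \<omega> \<in> \<Omega>" using shift_in by (simp add: space_noise_M)
  have "continuous_on UNIV (\<lambda>q. ou eps (shift q (shift (- t) \<omega>)) $ j)" for j
    using good \<omega> by (auto simp: good_noise_set_def)
  then have "continuous_on {0..} (\<lambda>q. \<chi> j. ou eps (shift q (shift (- t) \<omega>)) $ j)"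
    by (intro continuous_on_vec_lambda) (rule continuous_on_subset, auto)
  then show "continuous_on {0..} (\<lambda>q. ou eps (shift q (shift (- t) \<omega>)))" by simp
  show "solves (\<lambda>q. ou eps (shift q (shift (- t) \<omega>))) (\<lambda>q. Y q (shift (- t) \<omega>) (vec s, 0))"
    by (rule Y_solves[OF \<omega>])
  show "Y 0 (shift (- t) \<omega>) (vec s, 0) = (vec s, 0)" using \<omega> by simp
qed (rule assms)

text \<open>
  The distance to the limit set is the pointwise limit of the distances to the curves, where the
  latter are infima over rational parameters.
\<close>

lemma random_limit_set: "random_set noise_M nrm limit_set"
  unfolding random_set_def
proof
  fix x :: "'j phase"
  define d where "d n \<omega> = (INF q\<in>\<rat>. nrm (x - curve (real (Suc n)) \<omega> q))" for n \<omega>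
  show "(\<lambda>\<omega>. INF y\<in>limit_set \<omega>. nrm (x - y)) \<in> borel_measurable noise_M"
  proof (rule borel_measurable_LIMSEQ_metric[where f = d])
    fix n
    have nrm: "(\<lambda>y. nrm (x - y)) \<in> borel_measurable borel"
      by (intro borel_measurable_continuous_onI continuous_intros)
    show "d n \<in> borel_measurable noise_M"
      unfolding d_def
      by (intro borel_measurable_cINF_real measurable_compose[OF curve_measurable nrm]
          countable_rat) simp
  next
    fix \<omega> assume "\<omega> \<in> space noise_M"
    then have \<omega>: "\<omega> \<in> \<Omega>" by (simp add: space_noise_M)
    define D where "D = (INF y\<in>limit_set \<omega>. nrm (x - y))"
    have bdd: "bdd_below ((\<lambda>y. nrm (x - h y)) ` S)" for h and S :: "'z set"
      by (intro bdd_belowI[of _ 0]) auto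
    have ne: "limit_set \<omega> \<noteq> {}" using limit_set_point[OF \<omega>, of 0] by blast
    have tri: "nrm (x - z) \<le> nrm (x - y) + nrm (y - z)" for y z
      using nrm_triangle[of "x - y" "y - z"] by simp
    have "\<bar>d n \<omega> - D\<bar> \<le> err (real (Suc n)) \<omega>" for n
    proof -
      let ?T = "real (Suc n)"
      have T: "0 < ?T" by simp
      have "D - err ?T \<omega> \<le> d n \<omega>"
        unfolding d_def
      proof (rule cINF_greatest)
        fix q :: real
        obtain y where y: "y \<in> limit_set \<omega>" "coord y = coord (curve ?T \<omega> q)"
          using limit_set_point[OF \<omega>] by metis
        have "D \<le> nrm (x - y)" unfolding D_def by (rule cINF_lower[OF bdd[of id, simplified] y(1)])
        then show "D - err ?T \<omega> \<le> nrm (x - curve ?T \<omega> q)"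
          using tri[of y "curve ?T \<omega> q"] tri[of "y" "curve ?T \<omega> q"]
            nrm_triangle[of "x - curve ?T \<omega> q" "curve ?T \<omega> q - y"]
            limit_set_curve_close[OF \<omega> y(1) T y(2)[symmetric]] by simp
      qed (use Rats_0 in blast)
      moreover have "d n \<omega> - err ?T \<omega> \<le> D"
        unfolding D_def
      proof (rule cINF_greatest[OF ne])
        fix y assume y: "y \<in> limit_set \<omega>"
        obtain s where s: "coord (curve ?T \<omega> s) = coord y"
          using curve_surjective[OF \<omega> less_imp_le[OF T]] by metis
        have "d n \<omega> \<le> nrm (x - curve ?T \<omega> s)"
        proof (rule continuous_ge_on_closure[of "\<rat>" "\<lambda>s. nrm (x - curve ?T \<omega> s)" s])
          show "continuous_on (closure \<rat>) (\<lambda>s. nrm (x - curve ?T \<omega> s))"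
            by (intro continuous_intros continuous_curve[OF \<omega>]) simp
          show "s \<in> closure \<rat>" by (simp add: Rats_closure_real)
          show "d n \<omega> \<le> nrm (x - curve ?T \<omega> q)" if "q \<in> \<rat>" for q
            unfolding d_def by (rule cINF_lower[OF bdd that])
        qed
        also have "\<dots> \<le> nrm (x - y) + nrm (y - curve ?T \<omega> s)" by (rule tri)
        finally show "d n \<omega> - err ?T \<omega> \<le> nrm (x - y)"
          using limit_set_curve_close[OF \<omega> y T s] by (simp add: nrm_commute[of y])
      qed
      ultimately show ?thesis by (simp add: abs_le_iff)
    qed
    then have "(\<lambda>n. d n \<omega> - D) \<longlonglongrightarrow> 0"
      by (intro Lim_null_comparison[OF _ LIMSEQ_Suc[OF err_tendsto[of \<omega>]]]) auto
    then show "(\<lambda>n. d n \<omega>) \<longlonglongrightarrow> (INF y\<in>limit_set \<omega>. nrm (x - y))"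
      by (simp add: LIM_zero_iff D_def)
  qed
qed

end


section \<open>The attractor on the cylinder and its lift\<close>

context random_system
begin

lemma coset_eq_iff:
  "coset_p0 \<kappa> p = coset_p0 \<kappa> q \<longleftrightarrow> (\<exists>k :: int. q = p + of_int k *\<^sub>R (p0 :: 'j phase))"
proof
  assume "coset_p0 \<kappa> p = coset_p0 \<kappa> q"
  moreover have "q = q + of_int 0 *\<^sub>R p0" by simp
  then have "q \<in> coset_p0 \<kappa> q" unfolding coset_p0_def by blast
  ultimately have "q \<in> coset_p0 \<kappa> p" by (simp only:)
  then show "\<exists>k :: int. q = p + of_int k *\<^sub>R p0" unfolding coset_p0_def by blast
next
  assume "\<exists>k :: int. q = p + of_int k *\<^sub>R p0"
  then obtain k :: int where k: "q = p + of_int k *\<^sub>R p0" by blast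
  have "p + of_int i *\<^sub>R p0 = q + of_int (i - k) *\<^sub>R p0" "q + of_int i *\<^sub>R p0 = p + of_int (i + k)
      *\<^sub>R p0"
    for i by (simp_all add: k algebra_simps)
  then show "coset_p0 \<kappa> p = coset_p0 \<kappa> q" unfolding coset_p0_def by blast
qed

lemma mod_p0_eq_iff:
  "mod_p0 \<alpha> \<kappa> x = mod_p0 \<alpha> \<kappa> y \<longleftrightarrow> (\<exists>k :: int. y = x + of_int k *\<^sub>R (p0 :: 'j phase))"
proof
  assume eq: "mod_p0 \<alpha> \<kappa> x = mod_p0 \<alpha> \<kappa> y"
  then obtain k :: int where "P y = P x + of_int k *\<^sub>R p0" "Q x = Q y"
    by (auto simp: mod_p0_def coset_eq_iff)
  then have "P y + Q y = P x + Q x + of_int k *\<^sub>R p0" by simp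
  then show "\<exists>k :: int. y = x + of_int k *\<^sub>R p0" unfolding PQ by blast
next
  assume "\<exists>k :: int. y = x + of_int k *\<^sub>R p0"
  then obtain k :: int where "y = x + of_int k *\<^sub>R p0" by blast
  then have "P y = P x + of_int k *\<^sub>R p0" "Q y = Q x" by (simp_all only: P_p0 Q_p0)
  then show "mod_p0 \<alpha> \<kappa> x = mod_p0 \<alpha> \<kappa> y"
    unfolding mod_p0_def using coset_eq_iff by (simp only: prod.inject) blast
qed

lemma induced_map_mod_p0:
  assumes "\<omega> \<in> \<Omega>" "0 \<le> t"
  shows "induced_map \<alpha> \<kappa> Y t \<omega> (mod_p0 \<alpha> \<kappa> y) = mod_p0 \<alpha> \<kappa> (Y t \<omega> y)"
proof -
  have same: "mod_p0 \<alpha> \<kappa> (Y t \<omega> x) = mod_p0 \<alpha> \<kappa> (Y t \<omega> y)" if "mod_p0 \<alpha> \<kappa> x = mod_p0 \<alpha> \<kappa> y" for x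
    using that Y_translate[OF assms] unfolding mod_p0_eq_iff by metis
  have "(\<lambda>x. mod_p0 \<alpha> \<kappa> (Y t \<omega> x)) ` {x. mod_p0 \<alpha> \<kappa> x = mod_p0 \<alpha> \<kappa> y}
      = (\<lambda>x. mod_p0 \<alpha> \<kappa> (Y t \<omega> y)) ` {x. mod_p0 \<alpha> \<kappa> x = mod_p0 \<alpha> \<kappa> y}"
    by (rule image_cong[OF refl], rule same, drule CollectD)
  also have "\<dots> = {mod_p0 \<alpha> \<kappa> (Y t \<omega> y)}" by (rule image_constant[of y]) simp
  finally show ?thesis by (simp add: induced_map_def)
qed

lemma image_absorbing_tail:
  assumes \<omega>: "\<omega> \<in> \<Omega>" and t: "0 < t"
  shows "(\<Union>\<tau>\<in>{t..}. induced_map \<alpha> \<kappa> Y \<tau> (shift (- \<tau>) \<omega>) ` absorbing_set \<alpha> \<kappa> nrm R (shift (- \<tau>) \<omega>))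
    = mod_p0 \<alpha> \<kappa> ` tail t \<omega>"
proof -
  define T where "T \<tau> = {y. nrm (Q y) \<le> R (shift (- \<tau>) \<omega>)}" for \<tau>
  have absorbing: "absorbing_set \<alpha> \<kappa> nrm R (shift (- \<tau>) \<omega>) = mod_p0 \<alpha> \<kappa> ` T \<tau>" for \<tau>
    unfolding absorbing_set_def T_def by blast
  have "induced_map \<alpha> \<kappa> Y \<tau> (shift (- \<tau>) \<omega>) ` absorbing_set \<alpha> \<kappa> nrm R (shift (- \<tau>) \<omega>)
      = mod_p0 \<alpha> \<kappa> ` pull \<tau> \<omega> ` T \<tau>" if "\<tau> \<in> {t..}" for \<tau>
    unfolding absorbing image_image
    by (rule image_cong[OF refl]) (use induced_map_mod_p0[OF shift_in[OF \<omega>]] that t in \<open>simp add: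
        pull_def\<close>)
  moreover have tail: "tail t \<omega> = (\<Union>\<tau>\<in>{t..}. pull \<tau> \<omega> ` T \<tau>)"
    unfolding tail_def T_def by blast
  ultimately show ?thesis unfolding tail image_UN by (intro SUP_cong refl)
qed

lemma continuous_mod_p0: "continuous_map euclidean (cylinder_topology \<alpha> \<kappa>) (mod_p0 \<alpha> \<kappa> :: 'j phase
    \<Rightarrow> _)"
proof -
  have "continuous_map euclidean (top_of_set E1) P"
  proof -
    have "continuous_on UNIV P" by (intro continuous_on_P continuous_on_id)
    moreover have "range P \<subseteq> E1" by (auto simp: E1_eq P_eq)
    ultimately show ?thesis by (auto simp: continuous_map_in_subtopology)
  qed
  moreover have "continuous_map (top_of_set E1) (quotient_topology (top_of_set E1) (coset_p0 \<kappa>))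
      (coset_p0 \<kappa>)"
    by (rule quotient_imp_continuous_map[OF quotient_map_quotient_topology])
  ultimately have "continuous_map euclidean (quotient_topology (top_of_set E1) (coset_p0 \<kappa>))
      (coset_p0 \<kappa> \<circ> P)"
    by (rule continuous_map_compose)
  moreover have "continuous_map euclidean (top_of_set (E2 \<alpha>)) Q"
    by (auto simp: continuous_map_in_subtopology continuous_on_Q continuous_on_id E2_eq[OF
        alpha_nz])
  ultimately show ?thesis
    by (simp add: cylinder_topology_def continuous_map_pairwise mod_p0_def o_def)
qed

text \<open>
  The projection onto the cylinder is also open, so that closures commute with it on sets that are
  invariant under translations by \<open>p0\<close>. In the proof of the nontrivial direction, \<open>U\<close> and \<open>V\<close> are
  half-sized balls around the two parts of \<open>y\<close>, and the image of \<open>U\<close> in the quotient is open because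
  its preimage is a union of translates.
\<close>

lemma mod_p0_closure:
  assumes inv: "\<And>x (k :: int). x \<in> S \<Longrightarrow> x + of_int k *\<^sub>R p0 \<in> S"
  shows "mod_p0 \<alpha> \<kappa> y \<in> cylinder_topology \<alpha> \<kappa> closure_of (mod_p0 \<alpha> \<kappa> ` S) \<longleftrightarrow> y \<in> closure S"
proof
  assume "y \<in> closure S"
  then show "mod_p0 \<alpha> \<kappa> y \<in> cylinder_topology \<alpha> \<kappa> closure_of (mod_p0 \<alpha> \<kappa> ` S)"
    using continuous_map_image_closure_subset[OF continuous_mod_p0, of S] by auto
next
  assume cl: "mod_p0 \<alpha> \<kappa> y \<in> cylinder_topology \<alpha> \<kappa> closure_of (mod_p0 \<alpha> \<kappa> ` S)"
  have "\<exists>x\<in>S. dist x y < e" if e: "0 < e" for e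
  proof -
    define U where "U = E1 \<inter> ball (P y) (e / 2)"
    define V where "V = E2 \<alpha> \<inter> ball (Q y) (e / 2)"
    have preimage: "{x \<in> E1. coset_p0 \<kappa> x \<in> coset_p0 \<kappa> ` U} = E1 \<inter> (\<Union>k :: int. ball (P y + of_int
        k *\<^sub>R p0) (e / 2))"
    proof (intro equalityI subsetI)
      fix x assume "x \<in> {x \<in> E1. coset_p0 \<kappa> x \<in> coset_p0 \<kappa> ` U}"
      then obtain u where "x \<in> E1" "u \<in> U" "coset_p0 \<kappa> u = coset_p0 \<kappa> x" by auto
      then obtain k :: int where "x = u + of_int k *\<^sub>R p0" by (auto simp: coset_eq_iff)
      then have "dist (P y + of_int k *\<^sub>R p0) x < e / 2" using \<open>u \<in> U\<close> by (simp add: U_def)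
      then show "x \<in> E1 \<inter> (\<Union>k :: int. ball (P y + of_int k *\<^sub>R p0) (e / 2))"
        using \<open>x \<in> E1\<close> by auto
    next
      fix x assume "x \<in> E1 \<inter> (\<Union>k :: int. ball (P y + of_int k *\<^sub>R p0) (e / 2))"
      then obtain k :: int where x: "x \<in> E1" "dist (P y + of_int k *\<^sub>R p0) x < e / 2" by auto
      define u where "u = x + of_int (- k) *\<^sub>R p0"
      have "x = u + of_int k *\<^sub>R p0" by (simp add: u_def)
      moreover from this have "dist (P y) u < e / 2" using x(2) by simp
      moreover have "u \<in> E1"
        using x(1) unfolding u_def E1_def by (rule span_add[OF _ span_scale[OF span_scale[OF
            span_base]]]) auto
      ultimately have "u \<in> U" "coset_p0 \<kappa> u = coset_p0 \<kappa> x"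
        by (auto simp: U_def coset_eq_iff)
      then show "x \<in> {x \<in> E1. coset_p0 \<kappa> x \<in> coset_p0 \<kappa> ` U}" using x(1) by (auto simp: image_iff)
    qed
    have "openin (top_of_set E1) {x \<in> E1. coset_p0 \<kappa> x \<in> coset_p0 \<kappa> ` U}"
      unfolding preimage by (intro openin_open_Int open_UN ballI open_ball)
    moreover have "coset_p0 \<kappa> ` U \<subseteq> coset_p0 \<kappa> ` E1" by (auto simp: U_def)
    ultimately have "openin (quotient_topology (top_of_set E1) (coset_p0 \<kappa>)) (coset_p0 \<kappa> ` U)"
      by (simp only: openin_quotient_topology topspace_euclidean_subtopology simp_thms)
    moreover have "openin (top_of_set (E2 \<alpha>)) V" by (auto simp: V_def openin_open)
    ultimately have opn: "openin (cylinder_topology \<alpha> \<kappa>) ((coset_p0 \<kappa> ` U) \<times> V)"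
      by (simp add: cylinder_topology_def openin_prod_Times_iff)
    have mem: "mod_p0 \<alpha> \<kappa> y \<in> (coset_p0 \<kappa> ` U) \<times> V"
      using e by (auto simp: mod_p0_def U_def V_def E2_eq[OF alpha_nz] E1_eq P_eq)
    obtain c where c: "c \<in> mod_p0 \<alpha> \<kappa> ` S" "c \<in> (coset_p0 \<kappa> ` U) \<times> V"
      using in_closure_of[THEN iffD1, OF cl, THEN conjunct2, rule_format, OF conjI[OF mem opn]]
      by (elim exE conjE)
    from c(1) obtain s where s: "c = mod_p0 \<alpha> \<kappa> s" "s \<in> S" by (rule imageE)
    from c(2) obtain u where u: "u \<in> U" "coset_p0 \<kappa> (P s) = coset_p0 \<kappa> u" and V: "Q s \<in> V"
      by (auto simp: mod_p0_def s(1))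
    obtain k :: int where k: "u = P s + of_int k *\<^sub>R p0" using u(2) by (auto simp: coset_eq_iff)
    have "s + of_int k *\<^sub>R p0 = u + Q s" using PQ[of s] by (simp add: k algebra_simps)
    moreover have "dist (u + Q s) y < e"
    proof -
      have "dist (u + Q s) (P y + Q y) \<le> dist u (P y) + dist (Q s) (Q y)" by (rule
          dist_triangle_add)
      also have "\<dots> < e / 2 + e / 2"
        using u(1) V by (intro add_strict_mono) (auto simp: U_def V_def dist_commute)
      finally show ?thesis by (simp add: PQ)
    qed
    ultimately show ?thesis using inv[OF s(2), of k] by metis
  qed
  then show "y \<in> closure S" by (simp add: closure_approachable)
qed

lemma global_attractor_eq:
  assumes \<omega>: "\<omega> \<in> \<Omega>"
  shows "global_attractor \<alpha> \<kappa> nrm R Y \<omega> = limit_set \<omega>"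
proof -
  have "mod_p0 \<alpha> \<kappa> y \<in> cylinder_attractor \<alpha> \<kappa> nrm R Y \<omega> \<longleftrightarrow> y \<in> limit_set \<omega>" for y
  proof -
    have "mod_p0 \<alpha> \<kappa> y \<in> cylinder_topology \<alpha> \<kappa> closure_of
        (\<Union>\<tau>\<in>{t..}. induced_map \<alpha> \<kappa> Y \<tau> (shift (- \<tau>) \<omega>) ` absorbing_set \<alpha> \<kappa> nrm R (shift (- \<tau>) \<omega>))
        \<longleftrightarrow> y \<in> closure (tail t \<omega>)" if "0 < t" for t
      unfolding image_absorbing_tail[OF \<omega> that]
      by (rule mod_p0_closure) (use tail_translate[OF \<omega>] that in auto)
    then show ?thesis by (simp add: cylinder_attractor_def limit_set_def)
  qed
  then show ?thesis by (simp add: global_attractor_def)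
qed

text \<open>
  The limit set is the graph of the \<open>E2\<close>-part of the point \<open>pt \<omega> p\<close> over \<open>p\<close>, which is unique by
  \<open>limit_set_in_cone\<close>.
\<close>

lemma horizontal_curve:
  "random_horizontal_curve noise_M \<alpha> \<kappa> nrm (global_attractor \<alpha> \<kappa> nrm R Y)"
  unfolding random_horizontal_curve_def space_noise_M
proof
  show "random_set noise_M nrm (global_attractor \<alpha> \<kappa> nrm R Y)"
    unfolding random_set_def
  proof
    fix x :: "'j phase"
    have "(\<lambda>\<omega>. INF y\<in>limit_set \<omega>. nrm (x - y)) \<in> borel_measurable noise_M"
      using random_limit_set unfolding random_set_def by blast
    then show "(\<lambda>\<omega>. INF y\<in>global_attractor \<alpha> \<kappa> nrm R Y \<omega>. nrm (x - y)) \<in> borel_measurable noise_M"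
      by (rule measurable_cong[THEN iffD1, rotated]) (simp add: space_noise_M global_attractor_eq)
  qed
  define pt where "pt \<omega> p = (SOME y. y \<in> limit_set \<omega> \<and> P y = p)" for \<omega> and p :: "'j phase"
  have pt: "pt \<omega> p \<in> limit_set \<omega>" "P (pt \<omega> p) = p" if "\<omega> \<in> \<Omega>" "p \<in> E1" for \<omega> p
  proof -
    obtain c where "p = (vec c, 0)" using \<open>p \<in> E1\<close> by (auto simp: E1_eq)
    obtain y where "y \<in> limit_set \<omega>" "coord y = c"
      using limit_set_point[OF \<open>\<omega> \<in> \<Omega>\<close>] by blast
    then have "y \<in> limit_set \<omega> \<and> P y = p" using \<open>p = (vec c, 0)\<close> by (simp only: P_eq simp_thms)
    then have "pt \<omega> p \<in> limit_set \<omega> \<and> P (pt \<omega> p) = p" unfolding pt_def by (rule someI)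
    then show "pt \<omega> p \<in> limit_set \<omega>" "P (pt \<omega> p) = p" by auto
  qed
  have lip: "nrm (Q x - Q y) \<le> nrm (P x - P y)" if "\<omega> \<in> \<Omega>" "x \<in> limit_set \<omega>" "y \<in> limit_set \<omega>" for
      \<omega> x y
    using limit_set_in_cone[OF that] by (simp add: Q_diff P_diff)
  have Q_unique: "Q x = Q y" if "\<omega> \<in> \<Omega>" "x \<in> limit_set \<omega>" "y \<in> limit_set \<omega>" "P x = P y" for \<omega> x y
    using lip[OF that(1-3)] that(4) nrm_eq_0[of "Q x - Q y"] by (simp add: antisym)
  show "\<exists>\<Phi>. \<forall>\<omega>\<in>\<Omega>. \<Phi> \<omega> ` E1 \<subseteq> E2 \<alpha> \<and>
      global_attractor \<alpha> \<kappa> nrm R Y \<omega> = {p + \<Phi> \<omega> p | p. p \<in> E1} \<and>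
      (\<forall>p\<in>E1. \<forall>q\<in>E1. nrm (\<Phi> \<omega> p - \<Phi> \<omega> q) \<le> nrm (p - q)) \<and>
      (\<forall>p\<in>E1. \<Phi> \<omega> (p + \<kappa> *\<^sub>R eta0) = \<Phi> \<omega> p)"
  proof (intro exI[of _ "\<lambda>\<omega> p. Q (pt \<omega> p)"] ballI conjI)
    fix \<omega> assume \<omega>: "\<omega> \<in> \<Omega>"
    show "(\<lambda>p. Q (pt \<omega> p)) ` E1 \<subseteq> E2 \<alpha>" by (auto simp: E2_eq[OF alpha_nz])
    show "global_attractor \<alpha> \<kappa> nrm R Y \<omega> = {p + Q (pt \<omega> p) | p. p \<in> E1}"
      unfolding global_attractor_eq[OF \<omega>]
    proof (intro equalityI subsetI)
      fix y assume y: "y \<in> limit_set \<omega>"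
      have E1: "P y \<in> E1" by (auto simp: P_eq E1_eq)
      then have "Q y = Q (pt \<omega> (P y))" using Q_unique[OF \<omega> y] pt[OF \<omega> E1] by simp
      then have "y = P y + Q (pt \<omega> (P y))" using PQ[of y] by simp
      then show "y \<in> {p + Q (pt \<omega> p) | p. p \<in> E1}" using E1 by blast
    next
      fix y assume "y \<in> {p + Q (pt \<omega> p) | p. p \<in> E1}"
      then obtain p where p: "p \<in> E1" "y = p + Q (pt \<omega> p)" by blast
      then have "y = pt \<omega> p" using pt(2)[OF \<omega> p(1)] PQ[of "pt \<omega> p"] by simp
      then show "y \<in> limit_set \<omega>" using pt(1)[OF \<omega> p(1)] by simp
    qed
    fix p :: "'j phase" assume p: "p \<in> E1"
    show "nrm (Q (pt \<omega> p) - Q (pt \<omega> q)) \<le> nrm (p - q)" if "q \<in> E1" for q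
      using lip[OF \<omega> pt(1)[OF \<omega> p] pt(1)[OF \<omega> that]] pt(2)[OF \<omega> p] pt(2)[OF \<omega> that] by simp
    have E1: "p + p0 \<in> E1" using p by (auto simp: E1_eq p0_eq vec_add[symmetric])
    have "Q (pt \<omega> (p + p0)) = Q (pt \<omega> p + p0)"
      using Q_unique[OF \<omega> pt(1)[OF \<omega> E1] limit_set_translate[OF \<omega> pt(1)[OF \<omega> p]]]
        pt(2)[OF \<omega> E1] pt(2)[OF \<omega> p] P_p0[of "pt \<omega> p" 1] by simp
    then show "Q (pt \<omega> (p + \<kappa> *\<^sub>R eta0)) = Q (pt \<omega> p)" using Q_p0[of "pt \<omega> p" 1] by simp
  qed
qed

end

theorem theorem5p3:
  fixes N d :: nat
    and \<alpha> K \<beta> \<delta> \<kappa> c1 c2 a L_F M1 :: real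
    and A :: "real^('n::finite^'d::finite)^('n^'d)"
    and lam :: "nat \<Rightarrow> real"
    and f eps :: "real^('n^'d)"
    and g :: "real \<Rightarrow> real"
    and W :: "(real \<Rightarrow> real) measure"
    and \<Omega> :: "('n^'d) noise set"
    and Y :: "real \<Rightarrow> ('n^'d) noise \<Rightarrow> ('n^'d) phase \<Rightarrow> ('n^'d) phase"
    and r :: "('n^'d) noise \<Rightarrow> real"
  assumes "CARD('n) = N" and "CARD('d) = d" and "2 \<le> N" and "1 \<le> d"
    and "0 < \<alpha>" and "0 < K" and "0 < \<delta>" and "\<delta> \<le> 1"
    and "transpose A = A" and "\<forall>x. 0 \<le> (A *v x) \<bullet> x"
    and "simple_zero_spectrum A lam" and "A *v vec 1 = 0"
    and "g C1_differentiable_on UNIV" and "smallest_period g \<kappa>"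
    and "0 < c1" and "\<forall>x. \<bar>g x\<bar> \<le> c1"
    and "0 < c2" and "\<forall>x. \<bar>deriv g x\<bar> \<le> c2"
    and "two_sided_wiener W" and "good_noise_set W eps \<Omega>"
    and "solution_map A \<alpha> K \<beta> f g eps \<Omega> Y"
    and "0 < M1" and "\<forall>y. norm_E A \<alpha> K \<delta> (lam 1) y \<le> M1 * norm y"
    and "tempered_rv (restrict_space (noise_space W) \<Omega>) r"
    and "\<forall>\<omega>\<in>\<Omega>. \<forall>t.
           norm (ou eps (shift t \<omega>)) \<le> exp (a / 2 * \<bar>t\<bar>) * r \<omega> \<and>
           exp (- (a / 2) * \<bar>t\<bar>) * r \<omega> \<le> r (shift t \<omega>) \<and>
           r (shift t \<omega>) \<le> exp (a / 2 * \<bar>t\<bar>) * r \<omega>"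
    and "a = \<alpha> / 2 - \<bar>\<alpha> / 2 - \<delta> * K * lam 1 / \<alpha>\<bar>"
    and "L_F = 2 * c2 * \<bar>\<beta>\<bar> / \<alpha>"
    and "a > 4 * L_F"
    and "\<exists>\<gamma>. 0 < \<gamma> \<and> \<gamma> < a / 2 \<and>
           2 * c2 * \<bar>\<beta>\<bar> / \<alpha> * (1 / \<gamma> + 1 / (a - 2 * \<gamma>)) < 1"
  shows "random_horizontal_curve (restrict_space (noise_space W) \<Omega>) \<alpha> \<kappa>
           (norm_E A \<alpha> K \<delta> (lam 1))
           (global_attractor \<alpha> \<kappa> (norm_E A \<alpha> K \<delta> (lam 1))
              (absorbing_radius \<alpha> \<beta> f a c1 M1 r) Y)"
proof -
  have card: "2 \<le> CARD('n^'d)"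
  proof -
    have "(2::nat) ^ 1 \<le> 2 ^ d" using assms(4) by (intro power_increasing) auto
    also have "\<dots> \<le> N ^ d" using assms(3) by (intro power_mono) auto
    finally show ?thesis using assms(1,2) by simp
  qed
  interpret adapted_form A \<alpha> K \<delta> "lam 1"
  proof
    show "0 < lam 1" using assms(11) by (simp add: simple_zero_spectrum_def)
    show "lam 1 * (u \<bullet> u) \<le> (A *v u) \<bullet> u" if "u \<bullet> vec 1 = 0" for u
      by (rule spectral_gap[OF assms(9) assms(10) assms(11) assms(12) card that])
  qed (fact assms)+
  have rate: "rate = a" unfolding rate_def assms(26) ..
  interpret damped_system A \<alpha> K \<delta> "lam 1" \<beta> f g \<kappa> c1 c2 M1 L_F
  proof
    show "\<bar>g x - g y\<bar> \<le> c2 * \<bar>x - y\<bar>" for x y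
      by (rule lipschitz_of_deriv_bound[OF assms(13)]) (use assms(18) in blast)
    show "0 \<le> c2" using assms(17) by simp
    show "4 * L_F < rate" using assms(28) rate by simp
  qed (use assms in \<open>auto simp: smallest_period_def\<close>)
  have space: "space (restrict_space (noise_space W) \<Omega>) = \<Omega>"
    using assms(20) sets.sets_into_space[of \<Omega> "noise_space W"]
    by (auto simp: space_restrict_space good_noise_set_def)
  interpret random_system A \<alpha> K \<delta> "lam 1" \<beta> f g \<kappa> c1 c2 M1 L_F W eps \<Omega> Y r
  proof
    show "0 < r \<omega>" if "\<omega> \<in> \<Omega>" for \<omega>
      using assms(24) that unfolding tempered_rv_def space by blast
    show "norm (ou eps (shift t \<omega>)) \<le> exp (rate / 2 * \<bar>t\<bar>) * r \<omega>" if "\<omega> \<in> \<Omega>" for \<omega> t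
      using assms(25) that unfolding rate by blast
    show "r (shift t \<omega>) \<le> exp (rate / 2 * \<bar>t\<bar>) * r \<omega>" if "\<omega> \<in> \<Omega>" for \<omega> t
      using assms(25) that unfolding rate by blast
  qed (fact assms)+
  show ?thesis using horizontal_curve unfolding rate .
qed

end
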